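(* Let $T$ be a virtual $2$-tangle with standard orientation. For any (virtual) $2$-tangle $T'$ with compatible orientation, $f(T\cup T')-f(\rho^1(T)\cup T')$ is divisible in $\mathbb{Z}[A,A^{-1}]$ by $f(T(m_1))-f(T(m_2))$, where $m_1=((1,2),(3,4))$ and $m_2=((1,4),(2,3))$.
   Context: **Auxiliary polynomial.** Virtual link diagrams have classical and virtual crossings. For an oriented virtual link diagram $D$, $f(D)=(-A^3)^{-w(D)}\langle D\rangle\in\mathbb{Z}[A,A^{-1}]$, where $w$ is the writhe (sum of signs of classical crossings) and $\langle\cdot\rangle$ is the Kauffman bracket: at a classical crossing drawn so that the over-strand runs from bottom left to top right, $\langle D\rangle=A\langle D_A\rangle+A^{-1}\langle D_B\rangle$, where $D_A$ joins the two left ends together and the two right ends together, and $D_B$ joins the two top ends together and the two bottom ends together; $\langle\bigcirc\sqcup D\rangle=(-A^2-A^{-2})\langle D\rangle$; $\langle\bigcirc\rangle=1$ (virtual crossings are not smoothed; a curve with only virtual crossings counts as $\bigcirc$). **Tangles.** A (virtual) $2$-tangle is a tangle diagram in a disk, possibly with virtual crossings and closed components, with four endpoints, the $i$-th at angle $-\pi i/2$. $T\cup T'$ is the virtual link diagram obtained by gluing the $i$-th endpoint of $T$ to the $i$-th endpoint of a complementary tangle $T'$. $T$ has standard orientation if its endpoints $1,2,3,4$ are outbound, inbound, outbound, inbound respectively; $T'$ has compatible orientation if the orientations agree at the glued endpoints. **Rotation and closures.** $\rho^1(T)$ is the tangle obtained by rotating $T$ clockwise by $\pi/2$ radians and then reversing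 the orientation of every strand (including closed components); it again has standard orientation. $T(m_1)$, $T(m_2)$ are the virtual links obtained by joining endpoints $1$–$2$ and $3$–$4$ (respectively $1$–$4$ and $2$–$3$) of $T$ by crossingless arcs outside the disk, oriented by $T$. *)

theory Defs
  imports Main "HOL-Library.Poly_Mapping"
begin

text \<open>
  Virtual link and tangle diagrams are represented by their underlying maps: finitely many
  vertices, the ends (\<open>darts\<close>) of the edges at every vertex listed in counterclockwise order,
  an involution \<open>edge\<close> exchanging the two ends of each edge, and an orientation of the edges,
  given by the set \<open>tails\<close> of darts at which an edge starts.

  Besides classical and virtual crossings, vertices of degree two are allowed. These are marked
  points on a curve, which are not part of the diagram drawn in the plane; a circle without
  crossings is a marked point whose two darts are exchanged by \<open>edge\<close>. The four endpoints of a
  tangle are vertices of degree one. The kinds \<open>Split_A\<close> and \<open>Split_B\<close> are smoothed classical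
  crossings; they occur only while the Kauffman bracket is evaluated.

  The position of different connected components relative to each other in the plane is not
  recorded; neither the writhe nor the bracket depends on it.
\<close>

datatype kind = Terminal | Point | Virtual | Classical | Split_A | Split_B

record 'v diagram =
  verts :: "'v set"
  kind :: "'v \<Rightarrow> kind"
  edge :: "'v \<times> nat \<Rightarrow> 'v \<times> nat"
  tails :: "('v \<times> nat) set"

fun valence :: "kind \<Rightarrow> nat" where
  "valence Terminal = 1"
| "valence Point = 2"
| "valence _ = 4"

definition darts :: "'v diagram \<Rightarrow> ('v \<times> nat) set" where
  "darts D = {(v, k). v \<in> verts D \<and> k < valence (kind D v)}"

text \<open>
  A classical crossing is drawn so that its over-strand runs from bottom left to top right. Its
  darts are then 0 (bottom left), 1 (bottom right), 2 (top right), 3 (top left), the over-strand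
  being 0-2. Turning the picture by a half turn gives the other admissible numbering; nothing below
  depends on this choice.

  \<open>through\<close> tells how the darts at a vertex are connected: straight on at a crossing, left with
  left and right with right at an \<open>A\<close>-smoothing, top with top and bottom with bottom at
  a \<open>B\<close>-smoothing.
\<close>

fun through :: "kind \<Rightarrow> nat \<Rightarrow> nat" where
  "through Terminal k = k"
| "through Point k = 1 - k"
| "through Virtual k = (k + 2) mod 4"
| "through Classical k = (k + 2) mod 4"
| "through Split_A k = 3 - k"
| "through Split_B k = (if even k then k + 1 else k - 1)"

definition thru :: "'v diagram \<Rightarrow> 'v \<times> nat \<Rightarrow> 'v \<times> nat" where
  "thru D = (\<lambda>(v, k). (v, through (kind D v) k))"

definition wf_diagram :: "'v diagram \<Rightarrow> bool" where
  "wf_diagram D \<longleftrightarrow>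
     finite (verts D) \<and>
     (\<forall>v \<in> verts D. kind D v \<in> {Terminal, Point, Virtual, Classical}) \<and>
     (\<forall>x \<in> darts D. edge D x \<in> darts D \<and> edge D x \<noteq> x \<and> edge D (edge D x) = x) \<and>
     tails D \<subseteq> darts D \<and>
     (\<forall>x \<in> darts D. edge D x \<in> tails D \<longleftrightarrow> x \<notin> tails D) \<and>
     (\<forall>x \<in> darts D. kind D (fst x) \<noteq> Terminal \<longrightarrow> (thru D x \<in> tails D \<longleftrightarrow> x \<notin> tails D))"

text \<open>The number of orbits on \<open>S\<close> of the group generated by a set \<open>F\<close> of permutations of the finite
  set \<open>S\<close>.\<close>

definition orbit_count :: "('a \<Rightarrow> 'a) set \<Rightarrow> 'a set \<Rightarrow> nat" where
  "orbit_count F S = card ((\<lambda>x. {(u, g u) | u g. u \<in> S \<and> g \<in> F}\<^sup>* `` {x}) ` S)"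


section \<open>The Kauffman bracket and the auxiliary polynomial\<close>

text \<open>The ring of Laurent polynomials in \<open>A\<close> (here \<open>laurent_A\<close>) over the integers is the group ring of the integers,
  that is, finitely supported functions from exponents to coefficients with convolution as
  multiplication.\<close>

type_synonym laurent = "int \<Rightarrow>\<^sub>0 int"

definition laurent_A :: laurent where "laurent_A = Poly_Mapping.single 1 1"
definition laurent_A_inv :: laurent where "laurent_A_inv = Poly_Mapping.single (-1) 1"

lemma laurent_A_inverse: "laurent_A * laurent_A_inv = 1"
  by (simp add: laurent_A_def laurent_A_inv_def mult_single)

definition classical :: "'v diagram \<Rightarrow> 'v set" where
  "classical D = {v \<in> verts D. kind D v = Classical}"

definition smooth :: "kind \<Rightarrow> 'v \<Rightarrow> 'v diagram \<Rightarrow> 'v diagram" where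
  "smooth s v D = D\<lparr>kind := (kind D)(v := s)\<rparr>"

text \<open>The number of closed curves of a diagram; virtual crossings are passed straight.\<close>

definition curves :: "'v diagram \<Rightarrow> nat" where
  "curves D = orbit_count {edge D, thru D} (darts D)"

primrec bracket_rec :: "nat \<Rightarrow> 'v diagram \<Rightarrow> laurent" where
  "bracket_rec 0 D = (- (laurent_A ^ 2) - laurent_A_inv ^ 2) ^ (curves D - 1)"
| "bracket_rec (Suc n) D =
     (let v = SOME v. v \<in> classical D
      in laurent_A * bracket_rec n (smooth Split_A v D) + laurent_A_inv * bracket_rec n (smooth Split_B v D))"

definition bracket :: "'v diagram \<Rightarrow> laurent" where
  "bracket D = bracket_rec (card (classical D)) D"

lemma classical_smooth:
  "s \<noteq> Classical \<Longrightarrow> classical (smooth s v D) = classical D - {v}"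
  by (auto simp: classical_def smooth_def)

lemma smooth_commute:
  "v \<noteq> w \<Longrightarrow> smooth s v (smooth t w D) = smooth t w (smooth s v D)"
  by (simp add: smooth_def fun_upd_twist)

lemma bracket_rec_skein:
  "card (classical D) = Suc n \<Longrightarrow> v \<in> classical D \<Longrightarrow>
   bracket_rec (Suc n) D =
     laurent_A * bracket_rec n (smooth Split_A v D) + laurent_A_inv * bracket_rec n (smooth Split_B v D)"
proof (induction n arbitrary: D v)
  case 0
  then have "classical D = {v}"
    by (metis One_nat_def card_1_singletonE singletonD)
  then show ?case by simp
next
  case (Suc n)
  define w where "w = (SOME v. v \<in> classical D)"
  have w: "w \<in> classical D"
    unfolding w_def using Suc.prems(2) by (rule someI)
  have fin: "finite (classical D)"
    using Suc.prems(1) by (metis card.infinite nat.distinct(1))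
  have unfold: "bracket_rec (Suc (Suc n)) D =
      laurent_A * bracket_rec (Suc n) (smooth Split_A w D) + laurent_A_inv * bracket_rec (Suc n) (smooth Split_B w D)"
    by (simp add: w_def Let_def)
  show ?case
  proof (cases "v = w")
    case True
    then show ?thesis using unfold by simp
  next
    case False
    have step: "bracket_rec (Suc n) (smooth s x D) =
        laurent_A * bracket_rec n (smooth Split_A y (smooth s x D)) +
        laurent_A_inv * bracket_rec n (smooth Split_B y (smooth s x D))"
      if "s \<noteq> Classical" "x \<in> classical D" "y \<in> classical D" "x \<noteq> y" for s x y
      using that fin Suc.prems(1) by (intro Suc.IH) (auto simp: classical_smooth)
    have "smooth s v (smooth t w D) = smooth t w (smooth s v D)" for s t
      using False by (rule smooth_commute)
    with False w Suc.prems(2) show ?thesis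
      unfolding unfold
      by (simp add: step[of _ w v] step[of _ v w] algebra_simps del: bracket_rec.simps)
  qed
qed

text \<open>The result does not depend on the crossing chosen in the recursion.\<close>

lemma bracket_skein:
  assumes "finite (verts D)" "v \<in> classical D"
  shows "bracket D = laurent_A * bracket (smooth Split_A v D) + laurent_A_inv * bracket (smooth Split_B v D)"
proof -
  have fin: "finite (classical D)"
    using assms(1) by (simp add: classical_def)
  with assms(2) obtain n where n: "card (classical D) = Suc n"
    by (metis card_gt_0_iff empty_iff gr0_implies_Suc)
  moreover have "card (classical (smooth s v D)) = n" if "s \<noteq> Classical" for s
    using that n fin assms(2) by (simp add: classical_smooth)
  ultimately show ?thesis
    using bracket_rec_skein[OF n assms(2)] by (simp add: bracket_def del: bracket_rec.simps)
qed

text \<open>With the over-strand directed from bottom left to top right, a crossing is positive iff the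
  under-strand leaves at the top left.\<close>

definition crossing_sign :: "'v diagram \<Rightarrow> 'v \<Rightarrow> int" where
  "crossing_sign D v = (if (v, 2) \<in> tails D \<longleftrightarrow> (v, 3) \<in> tails D then 1 else -1)"

definition writhe :: "'v diagram \<Rightarrow> int" where
  "writhe D = (\<Sum>v \<in> classical D. crossing_sign D v)"

text \<open>\<open>unit_power m\<close> is the \<open>m\<close>-th power of \<open>- (A ^ 3)\<close>, a unit.\<close>

definition unit_power :: "int \<Rightarrow> laurent" where
  "unit_power m = (if m \<ge> 0 then (- (laurent_A ^ 3)) ^ nat m else (- (laurent_A_inv ^ 3)) ^ nat (- m))"

definition aux_poly :: "'v diagram \<Rightarrow> laurent" where
  "aux_poly D = unit_power (- writhe D) * bracket D"


section \<open>Tangles\<close>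

datatype 'c tvert = Endpoint nat | Inner 'c

text \<open>
  Collapsing the complementary region of the sphere turns the four endpoints of a tangle into one
  vertex of degree four; \<open>p\<close> is the counterclockwise successor of an endpoint at that vertex. The
  tangle is planar iff the resulting map has genus 0, i.e. the Euler formula
  \<open>V - E + F = 2 C\<close> holds with \<open>C\<close> the number of connected components.
\<close>

fun next_dart :: "(nat \<Rightarrow> nat) \<Rightarrow> 'c tvert diagram \<Rightarrow> 'c tvert \<times> nat \<Rightarrow> 'c tvert \<times> nat" where
  "next_dart p T (Endpoint i, k) = (Endpoint (p i), k)"
| "next_dart p T (Inner c, k) = (Inner c, Suc k mod valence (kind T (Inner c)))"

definition planar :: "(nat \<Rightarrow> nat) \<Rightarrow> 'c tvert diagram \<Rightarrow> bool" where
  "planar p T \<longleftrightarrow>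
     orbit_count {next_dart p T} (darts T) + orbit_count {next_dart p T \<circ> edge T} (darts T) =
     orbit_count {edge T} (darts T) + 2 * orbit_count {next_dart p T, edge T} (darts T)"

definition tangle_diagram :: "(nat \<Rightarrow> nat) \<Rightarrow> 'c tvert diagram \<Rightarrow> bool" where
  "tangle_diagram p T \<longleftrightarrow>
     wf_diagram T \<and>
     (\<forall>i. Endpoint i \<in> verts T \<longleftrightarrow> i \<in> {1..4}) \<and>
     (\<forall>v \<in> verts T. kind T v = Terminal \<longleftrightarrow> (\<exists>i. v = Endpoint i)) \<and>
     planar p T"

fun succ4 :: "nat \<Rightarrow> nat" where "succ4 i = (if i = 4 then 1 else i + 1)"
fun pred4 :: "nat \<Rightarrow> nat" where "pred4 i = (if i = 1 then 4 else i - 1)"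

text \<open>
  The \<open>i\<close>-th endpoint lies at the angle \<open>- \<pi> i / 2\<close>, so the endpoints follow each other clockwise
  around the disk. Around the collapsed exterior they follow each other counterclockwise. For a
  complementary tangle, drawn outside the disk, it is the disk itself that is collapsed.
\<close>

definition virtual_tangle :: "'c tvert diagram \<Rightarrow> bool" where
  "virtual_tangle T \<longleftrightarrow> tangle_diagram succ4 T"

definition complementary_tangle :: "'c tvert diagram \<Rightarrow> bool" where
  "complementary_tangle T \<longleftrightarrow> tangle_diagram pred4 T"

text \<open>The edge at an inbound endpoint is directed from the endpoint into the tangle.\<close>

definition inbound :: "'c tvert diagram \<Rightarrow> nat \<Rightarrow> bool" where
  "inbound T i \<longleftrightarrow> (Endpoint i, 0) \<in> tails T"

definition standard_orientation :: "'c tvert diagram \<Rightarrow> bool" where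
  "standard_orientation T \<longleftrightarrow> \<not> inbound T 1 \<and> inbound T 2 \<and> \<not> inbound T 3 \<and> inbound T 4"

definition compatible_orientation :: "'c tvert diagram \<Rightarrow> 'd tvert diagram \<Rightarrow> bool" where
  "compatible_orientation T T' \<longleftrightarrow> (\<forall>i \<in> {1..4}. inbound T' i \<longleftrightarrow> \<not> inbound T i)"


subsection \<open>Gluing\<close>

text \<open>The \<open>i\<close>-th endpoints of the two tangles become the marked point \<open>Seam i\<close>, with dart 0 on the
  side of the first tangle and dart 1 on the side of the second.\<close>

datatype ('c, 'd) gvert = Inside 'c | Outside 'd | Seam nat

fun in_dart :: "'c tvert \<times> nat \<Rightarrow> ('c, 'd) gvert \<times> nat" where
  "in_dart (Endpoint i, k) = (Seam i, 0)"
| "in_dart (Inner c, k) = (Inside c, k)"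

fun out_dart :: "'d tvert \<times> nat \<Rightarrow> ('c, 'd) gvert \<times> nat" where
  "out_dart (Endpoint i, k) = (Seam i, 1)"
| "out_dart (Inner d, k) = (Outside d, k)"

fun glue_kind :: "'c tvert diagram \<Rightarrow> 'd tvert diagram \<Rightarrow> ('c, 'd) gvert \<Rightarrow> kind" where
  "glue_kind T T' (Inside c) = kind T (Inner c)"
| "glue_kind T T' (Outside d) = kind T' (Inner d)"
| "glue_kind T T' (Seam i) = Point"

fun glue_edge ::
  "'c tvert diagram \<Rightarrow> 'd tvert diagram \<Rightarrow> ('c, 'd) gvert \<times> nat \<Rightarrow> ('c, 'd) gvert \<times> nat" where
  "glue_edge T T' (Inside c, k) = in_dart (edge T (Inner c, k))"
| "glue_edge T T' (Outside d, k) = out_dart (edge T' (Inner d, k))"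
| "glue_edge T T' (Seam i, k) =
     (if k = 0 then in_dart (edge T (Endpoint i, 0)) else out_dart (edge T' (Endpoint i, 0)))"

definition glue :: "'c tvert diagram \<Rightarrow> 'd tvert diagram \<Rightarrow> ('c, 'd) gvert diagram" where
  "glue T T' =
     \<lparr> verts = {Inside c | c. Inner c \<in> verts T} \<union> {Outside d | d. Inner d \<in> verts T'} \<union> Seam ` {1..4},
       kind = glue_kind T T',
       edge = glue_edge T T',
       tails = in_dart ` tails T \<union> out_dart ` tails T' \<rparr>"


subsection \<open>Rotation and closures\<close>

text \<open>A clockwise quarter turn moves the \<open>i\<close>-th endpoint to the place of the \<open>(i + 1)\<close>-st and keeps
  the cyclic order and the over-strand at every crossing.\<close>

fun turn :: "(nat \<Rightarrow> nat) \<Rightarrow> 'c tvert \<times> nat \<Rightarrow> 'c tvert \<times> nat" where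
  "turn p (Endpoint i, k) = (Endpoint (p i), k)"
| "turn p (Inner c, k) = (Inner c, k)"

definition rho :: "'c tvert diagram \<Rightarrow> 'c tvert diagram" where
  "rho T = T\<lparr> edge := turn succ4 \<circ> edge T \<circ> turn pred4,
              tails := turn succ4 ` (darts T - tails T) \<rparr>"

type_synonym matching = "(nat \<times> nat) \<times> (nat \<times> nat)"

fun partner :: "matching \<Rightarrow> nat \<Rightarrow> nat" where
  "partner ((a, b), (c, d)) i =
     (if i = a then b else if i = b then a else if i = c then d else c)"

definition arcs :: "matching \<Rightarrow> 'c tvert diagram \<Rightarrow> unit tvert diagram" where
  "arcs m T =
     \<lparr> verts = Endpoint ` {1..4},
       kind = (\<lambda>_. Terminal),
       edge = (\<lambda>(v, k). case v of Endpoint i \<Rightarrow> (Endpoint (partner m i), k) | Inner c \<Rightarrow> (v, k)),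
       tails = {(Endpoint i, 0) | i. i \<in> {1..4} \<and> \<not> inbound T i} \<rparr>"

definition tangle_closure :: "'c tvert diagram \<Rightarrow> matching \<Rightarrow> ('c, unit) gvert diagram" where
  "tangle_closure T m = glue T (arcs m T)"

end

theory Submission
  imports Defs
begin

text \<open>
  Smoothing all classical crossings of \<open>T\<close> leaves closed loops and arcs that pair up the four
  endpoints, so \<open>\<langle>T \<union> T'\<rangle> = (\<Sum>E F. a\<^sub>E b\<^sub>F d ^ (\<bar>E \<squnion> F\<bar> - 1))\<close>, where \<open>d = - A\<^sup>2 - A\<^sup>-\<^sup>2\<close>, \<open>E\<close> and \<open>F\<close> run
  over the pairings \<open>m\<^sub>1\<close>, \<open>m\<^sub>2\<close>, \<open>m\<^sub>3\<close> of the endpoints, and \<open>\<bar>E \<squnion> F\<bar>\<close> counts the blocks of the join.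
  Rotation exchanges \<open>m\<^sub>1\<close> and \<open>m\<^sub>2\<close> and fixes the crossing pairing \<open>m\<^sub>3\<close>; the rows of \<open>m\<^sub>1\<close> and \<open>m\<^sub>2\<close> in
  the matrix of the pairing differ by \<open>(d - 1, 1 - d, 0)\<close>. Hence the bracket changes by
  \<open>(a\<^sub>1 - a\<^sub>2) (b\<^sub>1 - b\<^sub>2) (d - 1)\<close> under rotation, whereas the brackets of the two closures of \<open>T\<close> differ
  by \<open>(a\<^sub>1 - a\<^sub>2) (d - 1)\<close>. The writhe is not affected by rotation and does not depend on the closure,
  and its contribution to the polynomial is a unit.
\<close>

section \<open>Connected components of glued relations\<close>

text \<open>In general only a reachability set; it is a connected component when \<open>r\<close> is
  symmetric. It has the shape of the sets counted by \<open>orbit_count\<close>.\<close>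

definition component :: "('a \<times> 'a) set \<Rightarrow> 'a \<Rightarrow> 'a set" where
  "component r x = r\<^sup>* `` {x}"

lemma component_eq_iff:
  assumes "sym r"
  shows "component r x = component r y \<longleftrightarrow> (x, y) \<in> r\<^sup>*"
proof -
  have "sym (r\<^sup>*)" by (rule sym_rtrancl[OF assms])
  then show ?thesis unfolding component_def
    by (auto dest: symD intro: rtrancl_trans)
qed

lemma rtrancl_in_field:
  "(x, y) \<in> r\<^sup>* \<Longrightarrow> r \<subseteq> X \<times> X \<Longrightarrow> x \<in> X \<Longrightarrow> y \<in> X"
  by (induction rule: rtrancl_induct) auto

text \<open>If both maps identify the same points of \<open>A\<close>, choosing a preimage under
  \<open>f\<close> and applying \<open>g\<close> is a bijection between the images. This counts
  components by indices without forming quotients.\<close>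

lemma card_image_same_kernel:
  assumes "\<And>a b. a \<in> A \<Longrightarrow> b \<in> A \<Longrightarrow> f a = f b \<longleftrightarrow> g a = g b"
  shows "card (f ` A) = card (g ` A)"
proof (rule bij_betw_same_card)
  have *: "g (inv_into A f (f a)) = g a" if "a \<in> A" for a
    using assms[of "inv_into A f (f a)" a] that by (simp add: f_inv_into_f inv_into_into)
  show "bij_betw (g \<circ> inv_into A f) (f ` A) (g ` A)"
    unfolding bij_betw_def
  proof
    show "inj_on (g \<circ> inv_into A f) (f ` A)"
      using assms by (auto intro!: inj_onI simp: *)
    show "(g \<circ> inv_into A f) ` f ` A = g ` A"
      unfolding image_image by (auto simp: * intro!: image_cong)
  qed
qed

section \<open>Graphs joined along matched points\<close>

definition linked :: "('a \<times> 'a) set \<Rightarrow> ('i \<Rightarrow> 'a) \<Rightarrow> 'i set \<Rightarrow> ('i \<times> 'i) set" where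
  "linked r p I = {(i, j). i \<in> I \<and> j \<in> I \<and> (p i, p j) \<in> r\<^sup>*}"

definition free_components :: "('a \<times> 'a) set \<Rightarrow> 'a set \<Rightarrow> 'a set \<Rightarrow> 'a set set" where
  "free_components r X P = {K \<in> component r ` X. K \<inter> P = {}}"

text \<open>Disjoint copies of two graphs with an edge between each pair of matched points, entered
  in both directions to keep the relation symmetric. The attaching points \<open>p\<close> and the
  embedding \<open>f\<close> are separate parameters, so that a rotation can be expressed by
  changing them while \<open>r\<close> stays fixed.\<close>

definition bridge ::
  "('a \<times> 'a) set \<Rightarrow> ('i \<Rightarrow> 'a) \<Rightarrow> ('a \<Rightarrow> 'g) \<Rightarrow> ('b \<times> 'b) set \<Rightarrow> ('i \<Rightarrow> 'b) \<Rightarrow> ('b \<Rightarrow> 'g) \<Rightarrow> 'i set \<Rightarrow> ('g \<times> 'g) set" where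
  "bridge r p f s q g I = map_prod f f ` r \<union> map_prod g g ` s \<union>
     (\<lambda>i. (f (p i), g (q i))) ` I \<union> (\<lambda>i. (g (q i), f (p i))) ` I"

lemma bridge_commute: "bridge r p f s q g I = bridge s q g r p f I"
  unfolding bridge_def by blast

lemma linked_sym: "sym r \<Longrightarrow> sym (linked r p I)"
  using sym_rtrancl[of r] unfolding linked_def by (auto simp: sym_def)

locale gluing =
  fixes X :: "'a set" and r :: "('a \<times> 'a) set" and p :: "'i \<Rightarrow> 'a" and f :: "'a \<Rightarrow> 'g"
    and Y :: "'b set" and s :: "('b \<times> 'b) set" and q :: "'i \<Rightarrow> 'b" and g :: "'b \<Rightarrow> 'g"
    and I :: "'i set"
  assumes finite: "finite X" "finite Y" "finite I"
    and field: "r \<subseteq> X \<times> X" "s \<subseteq> Y \<times> Y"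
    and sym: "sym r" "sym s"
    and ends: "p ` I \<subseteq> X" "q ` I \<subseteq> Y"
    and inj: "inj_on f X" "inj_on g Y"
    and disjoint: "f ` X \<inter> g ` Y = {}"
begin

abbreviation R where "R \<equiv> bridge r p f s q g I"
abbreviation L where "L \<equiv> linked r p I \<union> linked s q I"

lemma swapped: "gluing Y s q g X r p f I"
  using finite field sym ends inj disjoint by unfold_locales blast+

lemma sym_R: "sym R"
  using sym by (auto simp: sym_def bridge_def map_prod_def image_iff split: prod.splits) blast+

lemma lift: "(x, y) \<in> r\<^sup>* \<Longrightarrow> (f x, f y) \<in> R\<^sup>*"
proof (induction rule: rtrancl_induct)
  case (step y z)
  then have "(f y, f z) \<in> R" by (force simp: bridge_def)
  with step show ?case by (meson rtrancl.rtrancl_into_rtrancl)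
qed simp

lemma seam: "i \<in> I \<Longrightarrow> (f (p i), g (q i)) \<in> R" "i \<in> I \<Longrightarrow> (g (q i), f (p i)) \<in> R"
  by (auto simp: bridge_def)

text \<open>A path can leave the copy of \<open>X\<close> only along a seam edge, and those start at
  the points \<open>f (p i)\<close>. A component that avoids these points is therefore copied
  unchanged.\<close>

lemma component_free:
  assumes x: "x \<in> X" and free: "component r x \<inter> p ` I = {}"
  shows "component R (f x) = f ` component r x"
proof
  show "f ` component r x \<subseteq> component R (f x)"
    by (auto simp: component_def lift)
  have "\<exists>y. v = f y \<and> (x, y) \<in> r\<^sup>*" if "(f x, v) \<in> R\<^sup>*" for v
    using that
  proof (induction rule: rtrancl_induct)
    case (step v w)
    then obtain y where y: "v = f y" "(x, y) \<in> r\<^sup>*" by blast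
    have yX: "y \<in> X" using rtrancl_in_field[OF y(2) field(1) x] .
    have "y \<notin> p ` I" using free y(2) by (auto simp: component_def)
    moreover have "f y \<notin> g ` Y" using disjoint yX by blast
    moreover have "y = p i" if "f y = f (p i)" "i \<in> I" for i
      using that yX ends inj(1) by (auto dest: inj_onD)
    ultimately obtain a b where ab: "(a, b) \<in> r" "f y = f a" "w = f b"
      using step(2) y(1) field(2) ends unfolding bridge_def by auto
    then have "a = y" using inj(1) yX field(1) by (auto dest: inj_onD)
    then have "(x, b) \<in> r\<^sup>*" using ab(1) y(2) by (blast intro: rtrancl_into_rtrancl)
    then show ?case using ab(3) by blast
  qed auto
  then show "component R (f x) \<subseteq> f ` component r x"
    by (auto simp: component_def)
qed

text \<open>Invariant along a path: the current point is joined, within its own side, to a seam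
  point whose index \<open>j\<close> is reachable from \<open>i\<close> through links. Only a
  passage across a seam changes \<open>j\<close>.\<close>

lemma seam_reach:
  assumes i: "i \<in> I" and "(f (p i), v) \<in> R\<^sup>*"
  shows "\<exists>j\<in>I. (i, j) \<in> L\<^sup>* \<and>
    ((\<exists>y. v = f y \<and> (p j, y) \<in> r\<^sup>*) \<or> (\<exists>y. v = g y \<and> (q j, y) \<in> s\<^sup>*))"
  using assms(2)
proof (induction rule: rtrancl_induct)
  case base
  then show ?case using i by blast
next
  case (step v w)
  then obtain j where j: "j \<in> I" "(i, j) \<in> L\<^sup>*"
    and alt: "(\<exists>y. v = f y \<and> (p j, y) \<in> r\<^sup>*) \<or> (\<exists>y. v = g y \<and> (q j, y) \<in> s\<^sup>*)" by blast
  \<comment> \<open>Disjointness of the two images decides which alternative of \<open>alt\<close>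
    applies, and injectivity recovers the point from its image.\<close>
  have A: "(p j, y) \<in> r\<^sup>*" if "v = f y" "y \<in> X" for y
    using alt
  proof
    assume "\<exists>y. v = f y \<and> (p j, y) \<in> r\<^sup>*"
    then obtain z where z: "v = f z" "(p j, z) \<in> r\<^sup>*" by blast
    then have "z \<in> X" using rtrancl_in_field[OF z(2) field(1)] ends j by blast
    then show ?thesis using z that inj by (metis inj_onD)
  next
    assume "\<exists>y. v = g y \<and> (q j, y) \<in> s\<^sup>*"
    then obtain z where z: "v = g z" "(q j, z) \<in> s\<^sup>*" by blast
    then have "z \<in> Y" using rtrancl_in_field[OF z(2) field(2)] ends j by blast
    then show ?thesis using z that disjoint by blast
  qed
  have B: "(q j, y) \<in> s\<^sup>*" if "v = g y" "y \<in> Y" for y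
    using alt
  proof
    assume "\<exists>y. v = g y \<and> (q j, y) \<in> s\<^sup>*"
    then obtain z where z: "v = g z" "(q j, z) \<in> s\<^sup>*" by blast
    then have "z \<in> Y" using rtrancl_in_field[OF z(2) field(2)] ends j by blast
    then show ?thesis using z that inj by (metis inj_onD)
  next
    assume "\<exists>y. v = f y \<and> (p j, y) \<in> r\<^sup>*"
    then obtain z where z: "v = f z" "(p j, z) \<in> r\<^sup>*" by blast
    then have "z \<in> X" using rtrancl_in_field[OF z(2) field(1)] ends j by blast
    then show ?thesis using z that disjoint by blast
  qed
  consider a b where "(a, b) \<in> r" "v = f a" "w = f b"
    | a b where "(a, b) \<in> s" "v = g a" "w = g b"
    | k where "k \<in> I" "v = f (p k)" "w = g (q k)"
    | k where "k \<in> I" "v = g (q k)" "w = f (p k)"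
    using step(2) unfolding bridge_def by auto
  then show ?case
  proof cases
    case 1
    with A[of a] field have "(p j, b) \<in> r\<^sup>*" by (meson SigmaD1 rtrancl.rtrancl_into_rtrancl subsetD)
    then show ?thesis using j 1 by blast
  next
    case 2
    with B[of a] field have "(q j, b) \<in> s\<^sup>*" by (meson SigmaD1 rtrancl.rtrancl_into_rtrancl subsetD)
    then show ?thesis using j 2 by blast
  next
    \<comment> \<open>The path reaches seam \<open>k\<close> from within \<open>X\<close>, so
      \<open>j\<close> and \<open>k\<close> are linked there; after the crossing \<open>k\<close> is
      the new index, with a trivial path on the other side.\<close>
    case 3
    with A[of "p k"] ends j have "(j, k) \<in> L" by (auto simp: linked_def)
    with j have "(i, k) \<in> L\<^sup>*" by (meson rtrancl.rtrancl_into_rtrancl)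
    then show ?thesis using 3 by blast
  next
    case 4
    with B[of "q k"] ends j have "(j, k) \<in> L" by (auto simp: linked_def)
    with j have "(i, k) \<in> L\<^sup>*" by (meson rtrancl.rtrancl_into_rtrancl)
    then show ?thesis using 4 by blast
  qed
qed

text \<open>Cut at its seam crossings, a path between seam points becomes a chain of links.
  Conversely a link on the first side lifts to a path, and so does one on the second side once a
  seam edge is added at either end.\<close>

lemma seam_connected_iff:
  assumes "i \<in> I" "j \<in> I"
  shows "(f (p i), f (p j)) \<in> R\<^sup>* \<longleftrightarrow> (i, j) \<in> L\<^sup>*"
proof
  assume "(f (p i), f (p j)) \<in> R\<^sup>*"
  from seam_reach[OF assms(1) this] obtain k where k: "k \<in> I" "(i, k) \<in> L\<^sup>*"
    and alt: "(\<exists>y. f (p j) = f y \<and> (p k, y) \<in> r\<^sup>*) \<or> (\<exists>y. f (p j) = g y \<and> (q k, y) \<in> s\<^sup>*)" by blast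
  from alt have "(p k, p j) \<in> r\<^sup>*"
  proof
    assume "\<exists>y. f (p j) = f y \<and> (p k, y) \<in> r\<^sup>*"
    then obtain y where y: "f (p j) = f y" "(p k, y) \<in> r\<^sup>*" by blast
    then have "y \<in> X" using rtrancl_in_field[OF y(2) field(1)] ends k by blast
    then show ?thesis using y inj ends assms by (metis image_subset_iff inj_onD)
  next
    assume "\<exists>y. f (p j) = g y \<and> (q k, y) \<in> s\<^sup>*"
    then obtain y where y: "f (p j) = g y" "(q k, y) \<in> s\<^sup>*" by blast
    then have "y \<in> Y" using rtrancl_in_field[OF y(2) field(2)] ends k by blast
    then show ?thesis using y disjoint ends assms by blast
  qed
  then have "(k, j) \<in> L" using k assms by (simp add: linked_def)
  with k show "(i, j) \<in> L\<^sup>*" by (meson rtrancl.rtrancl_into_rtrancl)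
next
  interpret swap: gluing Y s q g X r p f I by (rule swapped)
  assume "(i, j) \<in> L\<^sup>*"
  then show "(f (p i), f (p j)) \<in> R\<^sup>*"
  proof (induction rule: rtrancl_induct)
    case (step j k)
    from step(2) have "(f (p j), f (p k)) \<in> R\<^sup>*"
    proof
      assume "(j, k) \<in> linked r p I"
      then show ?thesis by (auto simp: linked_def lift)
    next
      assume "(j, k) \<in> linked s q I"
      then have I: "j \<in> I" "k \<in> I" and "(q j, q k) \<in> s\<^sup>*" by (auto simp: linked_def)
      then have "(g (q j), g (q k)) \<in> R\<^sup>*" 
        using swap.lift unfolding bridge_commute[of s q g r p f I] by blast
      with seam(1)[OF I(1)] seam(2)[OF I(2)] show ?thesis
        by (blast intro: converse_rtrancl_into_rtrancl rtrancl_into_rtrancl)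
    qed
    with step show ?case by (meson rtrancl_trans)
  qed simp
qed

lemma component_not_free:
  assumes "x \<in> X" "component r x \<inter> p ` I \<noteq> {}"
  shows "\<exists>i\<in>I. component R (f x) = component R (f (p i))"
proof -
  from assms obtain i where "i \<in> I" "(x, p i) \<in> r\<^sup>*" by (auto simp: component_def)
  then show ?thesis using lift component_eq_iff[OF sym_R] by blast
qed

text \<open>A component that meets the copy of \<open>X\<close> is the copy of a free component or
  passes through a seam point. The seam components stand on both sides so that the equation can be
  united with the one obtained by exchanging the two graphs.\<close>

lemma components_split:
  "component R ` f ` X \<union> (\<lambda>i. component R (f (p i))) ` I =
   image f ` free_components r X (p ` I) \<union> (\<lambda>i. component R (f (p i))) ` I" (is "?A = ?B")
proof
  show "?A \<subseteq> ?B"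
  proof
    fix K assume "K \<in> ?A"
    then consider "K \<in> (\<lambda>i. component R (f (p i))) ` I" | x where "x \<in> X" "K = component R (f x)"
      by blast
    then show "K \<in> ?B"
    proof cases
      case 2
      show ?thesis
      proof (cases "component r x \<inter> p ` I = {}")
        case True
        then show ?thesis using 2 component_free by (auto simp: free_components_def)
      next
        case False
        then show ?thesis using 2 component_not_free by blast
      qed
    qed blast
  qed
  have "f ` component r x \<in> component R ` f ` X" if "x \<in> X" "component r x \<inter> p ` I = {}" for x
    using component_free[OF that] that(1) by (metis imageI)
  then show "?B \<subseteq> ?A"
    by (auto simp: free_components_def)
qed

lemma free_component_subset: "K \<in> free_components r X P \<Longrightarrow> K \<subseteq> X \<and> K \<noteq> {}"
  using rtrancl_in_field[OF _ field(1)] by (auto simp: free_components_def component_def)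

text \<open>The components fall into three disjoint classes: free ones of either graph, which are
  merely copied, and those through a seam, which correspond to the classes of seam indices under the
  combined links.\<close>

theorem card_components:
  "card (component R ` (f ` X \<union> g ` Y)) =
     card (free_components r X (p ` I)) + card (free_components s Y (q ` I)) + card (component L ` I)"
proof -
  interpret swap: gluing Y s q g X r p f I by (rule swapped)
  note comm = bridge_commute[of s q g r p f I]
  let ?S = "(\<lambda>i. component R (f (p i))) ` I"
  let ?F = "image f ` free_components r X (p ` I)"
  let ?G = "image g ` free_components s Y (q ` I)"
  have same: "component R (g (q i)) = component R (f (p i))" if "i \<in> I" for i
    using seam(2)[OF that] component_eq_iff[OF sym_R] by blast
  then have S: "(\<lambda>i. component R (g (q i))) ` I = ?S" by (rule image_cong[OF refl])
  have "?S \<subseteq> component R ` f ` X" using ends by blast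
  then have "component R ` (f ` X \<union> g ` Y) =
      (component R ` f ` X \<union> ?S) \<union> (component R ` g ` Y \<union> (\<lambda>i. component R (g (q i))) ` I)"
    unfolding S by blast
  also have "\<dots> = ?F \<union> ?G \<union> ?S"
    using components_split swap.components_split unfolding comm S by auto
  finally have eq: "component R ` (f ` X \<union> g ` Y) = ?F \<union> ?G \<union> ?S" .
  have F: "K \<subseteq> f ` X \<and> K \<noteq> {}" if "K \<in> ?F" for K
    using that free_component_subset by blast
  have G: "K \<subseteq> g ` Y \<and> K \<noteq> {}" if "K \<in> ?G" for K
    using that swap.free_component_subset by blast
  have "K \<noteq> component R (f (p i))" if "K \<in> ?F \<or> K \<in> ?G" "i \<in> I" for K i
  proof
    assume K: "K = component R (f (p i))"
    then have "f (p i) \<in> K" "g (q i) \<in> K"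
      using seam(1)[OF that(2)] by (auto simp: component_def)
    then show False using that F[of K] G[of K] disjoint ends by blast
  qed
  then have dS: "(?F \<union> ?G) \<inter> ?S = {}" by auto
  have dFG: "?F \<inter> ?G = {}"
  proof (rule ccontr)
    assume "?F \<inter> ?G \<noteq> {}"
    then obtain K where "K \<in> ?F" "K \<in> ?G" by blast
    with F[of K] G[of K] disjoint show False by blast
  qed
  have fin: "finite ?F" "finite ?G" "finite ?S"
    using finite by (auto simp: free_components_def)
  have "card ?F = card (free_components r X (p ` I))"
    using inj_on_subset[OF inj_on_image_Pow[OF inj(1)]] free_component_subset
    by (intro card_image) blast
  moreover have "card ?G = card (free_components s Y (q ` I))"
    using inj_on_subset[OF inj_on_image_Pow[OF inj(2)]] swap.free_component_subset
    by (intro card_image) blast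
  moreover have "sym L" using linked_sym sym by (metis sym_Un)
  \<comment> \<open>By \<open>seam_connected_iff\<close> the two component maps on \<open>I\<close>
    identify the same indices.\<close>
  then have "card ?S = card (component L ` I)"
    by (intro card_image_same_kernel)
      (simp add: component_eq_iff sym_R seam_connected_iff)
  ultimately show ?thesis
    unfolding eq using fin dS dFG by (simp add: card_Un_disjoint)
qed

end


section \<open>The state sum\<close>

definition loop_value :: laurent where
  "loop_value = - (laurent_A ^ 2) - laurent_A_inv ^ 2"

text \<open>A Kauffman state is encoded by the set of its \<open>A\<close>-smoothed crossings, so
  that the states form a power set.\<close>

definition resolve :: "'v diagram \<Rightarrow> 'v set \<Rightarrow> 'v diagram" where
  "resolve D \<sigma> = D\<lparr>kind := (\<lambda>v. if v \<in> classical D then (if v \<in> \<sigma> then Split_A else Split_B) else kind D v)\<rparr>"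

definition weight :: "'v diagram \<Rightarrow> 'v set \<Rightarrow> laurent" where
  "weight D \<sigma> = laurent_A ^ card \<sigma> * laurent_A_inv ^ card (classical D - \<sigma>)"

text \<open>States are separated by their smoothing at \<open>v\<close>; the two sums match the two
  terms of the skein relation.\<close>

lemma sum_Pow_split:
  assumes "finite C" "v \<in> C"
  shows "sum h (Pow C) = (\<Sum>\<sigma>\<in>Pow (C - {v}). h (insert v \<sigma>)) + (\<Sum>\<sigma>\<in>Pow (C - {v}). h \<sigma>)"
proof -
  have "Pow C = insert v ` Pow (C - {v}) \<union> Pow (C - {v})"
    using Pow_insert[of v "C - {v}"] assms(2) by (simp add: insert_absorb Un_commute)
  moreover have "insert v ` Pow (C - {v}) \<inter> Pow (C - {v}) = {}" by blast
  moreover have "inj_on (insert v) (Pow (C - {v}))" by (rule inj_onI) blast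
  ultimately show ?thesis
    using assms(1) by (simp add: sum.union_disjoint sum.reindex)
qed

lemma resolve_smooth_A:
  "v \<in> classical D \<Longrightarrow> resolve (smooth Split_A v D) \<sigma> = resolve D (insert v \<sigma>)"
  by (auto simp: resolve_def smooth_def classical_def fun_eq_iff intro!: diagram.equality)

lemma resolve_smooth_B:
  "v \<in> classical D \<Longrightarrow> v \<notin> \<sigma> \<Longrightarrow> resolve (smooth Split_B v D) \<sigma> = resolve D \<sigma>"
  by (auto simp: resolve_def smooth_def classical_def fun_eq_iff intro!: diagram.equality)

text \<open>Induction on the number of classical crossings: the skein relation at any crossing
  \<open>v\<close> splits the states into those containing \<open>v\<close> and those omitting it,
  and its coefficient supplies the missing factor of the weight.\<close>

theorem bracket_state_sum:
  assumes "finite (verts D)"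
  shows "bracket D = (\<Sum>\<sigma>\<in>Pow (classical D). weight D \<sigma> * loop_value ^ (curves (resolve D \<sigma>) - 1))"
  using assms
proof (induction "card (classical D)" arbitrary: D)
  case 0
  then have "classical D = {}" by (simp add: classical_def)
  moreover from this have "resolve D {} = D" by (auto simp: resolve_def intro: diagram.equality)
  ultimately show ?case by (simp add: bracket_def weight_def loop_value_def)
next
  case (Suc n)
  define C where "C = classical D"
  from Suc.hyps(2) obtain v where v: "v \<in> C"
    unfolding C_def by (metis card.empty ex_in_conv nat.distinct(1))
  have fin: "finite C" using Suc.prems by (simp add: C_def classical_def)
  have cl: "classical (smooth s v D) = C - {v}" if "s \<noteq> Classical" for s
    using that by (simp add: classical_smooth C_def)
  have IH: "bracket (smooth s v D) = (\<Sum>\<sigma>\<in>Pow (C - {v}).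
      weight (smooth s v D) \<sigma> * loop_value ^ (curves (resolve (smooth s v D) \<sigma>) - 1))"
    if "s \<noteq> Classical" for s
  proof -
    have "n = card (classical (smooth s v D))" "finite (verts (smooth s v D))"
      using Suc.hyps(2) v fin that Suc.prems by (simp_all add: cl C_def[symmetric], simp add: smooth_def)
    then show ?thesis using Suc.hyps(1) cl[OF that] by metis
  qed
  have ne: "Split_A \<noteq> Classical" "Split_B \<noteq> Classical" by simp_all
  have wA: "laurent_A * weight (smooth Split_A v D) \<sigma> = weight D (insert v \<sigma>)"
    if "\<sigma> \<in> Pow (C - {v})" for \<sigma>
  proof -
    have "finite \<sigma>" "v \<notin> \<sigma>" using that fin by (auto dest: finite_subset)
    moreover have "C - {v} - \<sigma> = C - insert v \<sigma>" by blast
    ultimately show ?thesis by (simp add: weight_def cl C_def[symmetric] mult.assoc)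
  qed
  have wB: "laurent_A_inv * weight (smooth Split_B v D) \<sigma> = weight D \<sigma>"
    if "\<sigma> \<in> Pow (C - {v})" for \<sigma>
  proof -
    have "C - \<sigma> = insert v (C - {v} - \<sigma>)" using that v by blast
    then have "card (C - \<sigma>) = Suc (card (C - {v} - \<sigma>))" using fin by simp
    then show ?thesis by (simp add: weight_def cl C_def[symmetric] mult_ac)
  qed
  have "bracket D = laurent_A * bracket (smooth Split_A v D) + laurent_A_inv * bracket (smooth Split_B v D)"
    using bracket_skein[OF Suc.prems] v by (simp add: C_def)
  also have "laurent_A * bracket (smooth Split_A v D) = (\<Sum>\<sigma>\<in>Pow (C - {v}).
      weight D (insert v \<sigma>) * loop_value ^ (curves (resolve D (insert v \<sigma>)) - 1))"
    unfolding IH[OF ne(1)] sum_distrib_left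
    using v by (intro sum.cong[OF refl]) (simp add: wA[symmetric] resolve_smooth_A C_def mult.assoc)
  also have "laurent_A_inv * bracket (smooth Split_B v D) = (\<Sum>\<sigma>\<in>Pow (C - {v}).
      weight D \<sigma> * loop_value ^ (curves (resolve D \<sigma>) - 1))"
    unfolding IH[OF ne(2)] sum_distrib_left
  proof (intro sum.cong[OF refl])
    fix \<sigma> assume \<sigma>: "\<sigma> \<in> Pow (C - {v})"
    then have "resolve (smooth Split_B v D) \<sigma> = resolve D \<sigma>"
      using v by (intro resolve_smooth_B) (auto simp: C_def)
    then show "laurent_A_inv * (weight (smooth Split_B v D) \<sigma> *
        loop_value ^ (curves (resolve (smooth Split_B v D) \<sigma>) - 1)) =
        weight D \<sigma> * loop_value ^ (curves (resolve D \<sigma>) - 1)"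
      by (simp add: wB[OF \<sigma>, symmetric] mult.assoc)
  qed
  finally show ?case
    unfolding C_def[symmetric] sum_Pow_split[OF fin v] .
qed


section \<open>Strands of smoothed tangles\<close>

definition strand_rel :: "'v diagram \<Rightarrow> (('v \<times> nat) \<times> ('v \<times> nat)) set" where
  "strand_rel D = {(u, g u) | u g. u \<in> darts D \<and> g \<in> {edge D, thru D}}"

lemma strand_rel_edge: "u \<in> darts D \<Longrightarrow> (u, edge D u) \<in> strand_rel D"
  and strand_rel_thru: "u \<in> darts D \<Longrightarrow> (u, thru D u) \<in> strand_rel D"
  unfolding strand_rel_def by blast+

lemma strand_relE:
  assumes "(u, w) \<in> strand_rel D"
  obtains (edge) "u \<in> darts D" "w = edge D u" | (thru) "u \<in> darts D" "w = thru D u"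
  using assms unfolding strand_rel_def by blast

lemma curves_eq_components: "curves D = card (component (strand_rel D) ` darts D)"
  by (simp add: curves_def orbit_count_def component_def[abs_def] strand_rel_def)

lemma finite_darts: "finite (verts D) \<Longrightarrow> finite (darts D)"
proof -
  assume "finite (verts D)"
  moreover have "valence K \<le> 4" for K by (cases K) auto
  then have "darts D \<subseteq> verts D \<times> {..<4}"
    by (auto simp: darts_def intro: less_le_trans)
  ultimately show ?thesis by (auto intro: finite_subset)
qed

lemma through_valid:
  assumes "k < valence K"
  shows "through K k < valence K" "through K (through K k) = k" "through K k = k \<longleftrightarrow> K = Terminal"
proof -
  have "valence K \<le> 4" by (cases K) auto
  with assms have "k < 4" by simp
  then consider "k = 0" | "k = 1" | "k = 2" | "k = 3" by linarith
  note k = this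
  from k show "through K k < valence K"
    by cases (use assms in \<open>cases K; simp\<close>)+
  from k show "through K (through K k) = k"
    by cases (use assms in \<open>cases K; simp\<close>)+
  from k show "through K k = k \<longleftrightarrow> K = Terminal"
    by cases (use assms in \<open>cases K; simp\<close>)+
qed

lemma thru_darts: "x \<in> darts D \<Longrightarrow> thru D x \<in> darts D"
  and thru_thru: "x \<in> darts D \<Longrightarrow> thru D (thru D x) = x"
  and thru_fixed_iff: "x \<in> darts D \<Longrightarrow> thru D x = x \<longleftrightarrow> kind D (fst x) = Terminal"
  using through_valid by (auto simp: darts_def thru_def)

text \<open>The points moved by an involution come in pairs \<open>{x, f x}\<close>; the induction
  removes one pair at a time.\<close>

lemma even_card_moved:
  assumes "finite K" "\<And>x. x \<in> K \<Longrightarrow> f x \<in> K \<and> f (f x) = x"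
  shows "even (card {x \<in> K. f x \<noteq> x})"
  using assms
proof (induction K rule: finite_psubset_induct)
  case (psubset K)
  show ?case
  proof (cases "\<exists>x\<in>K. f x \<noteq> x")
    case False
    then have "{x \<in> K. f x \<noteq> x} = {}" by blast
    then show ?thesis by (metis card.empty even_zero)
  next
    case True
    then obtain x where x: "x \<in> K" "f x \<noteq> x" by blast
    let ?K = "K - {x, f x}"
    have "even (card {y \<in> ?K. f y \<noteq> y})"
    proof (rule psubset.IH)
      show "?K \<subset> K" using x by blast
      show "f y \<in> ?K \<and> f (f y) = y" if "y \<in> ?K" for y
        using that psubset.prems[of y] psubset.prems[of x] x by auto
    qed
    moreover have "{y \<in> K. f y \<noteq> y} = insert x (insert (f x) {y \<in> ?K. f y \<noteq> y})"
      using x psubset.prems[of x] by auto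
    then have "card {y \<in> K. f y \<noteq> y} = Suc (Suc (card {y \<in> ?K. f y \<noteq> y}))"
      using psubset.hyps(1) x by simp
    ultimately show ?thesis by simp
  qed
qed

text \<open>
  The conditions on a tangle diagram that survive smoothing; \<open>wf_diagram\<close> excludes \<open>Split_A\<close> and
  \<open>Split_B\<close>.
\<close>

definition strands :: "'c tvert diagram \<Rightarrow> bool" where
  "strands T \<longleftrightarrow> finite (verts T) \<and>
     (\<forall>x \<in> darts T. edge T x \<in> darts T \<and> edge T x \<noteq> x \<and> edge T (edge T x) = x) \<and>
     (\<forall>i. Endpoint i \<in> verts T \<longleftrightarrow> i \<in> {1..4}) \<and>
     (\<forall>v \<in> verts T. kind T v = Terminal \<longleftrightarrow> (\<exists>i. v = Endpoint i))"

definition end_dart :: "nat \<Rightarrow> 'c tvert \<times> nat" where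
  "end_dart i = (Endpoint i, 0)"

lemma end_dart_in_darts: "strands T \<Longrightarrow> end_dart i \<in> darts T \<longleftrightarrow> i \<in> {1..4}"
  by (cases "kind T (Endpoint i)") (auto simp: strands_def darts_def end_dart_def)

lemma terminal_dart:
  "strands T \<Longrightarrow> x \<in> darts T \<Longrightarrow> kind T (fst x) = Terminal \<longleftrightarrow> x \<in> end_dart ` {1..4}"
  by (cases x) (auto simp: strands_def darts_def end_dart_def)

lemma strand_rel_field: "strands T \<Longrightarrow> strand_rel T \<subseteq> darts T \<times> darts T"
  by (auto simp: strands_def thru_darts elim!: strand_relE)

lemma strand_rel_sym: "strands T \<Longrightarrow> sym (strand_rel T)"
  by (rule symI, erule strand_relE)
    (metis strands_def strand_rel_edge, metis strand_rel_thru thru_darts thru_thru)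

text \<open>Both \<open>edge\<close> and \<open>thru\<close> are involutions on a component; the first has no fixed point there,
  and the fixed points of the second are the endpoints.\<close>

lemma even_ends:
  assumes "strands T" and x: "x \<in> darts T"
  shows "even (card (component (strand_rel T) x \<inter> end_dart ` {1..4}))"
proof -
  let ?K = "component (strand_rel T) x"
  have sub: "?K \<subseteq> darts T"
    using rtrancl_in_field[OF _ strand_rel_field[OF assms(1)] x] by (auto simp: component_def)
  have "finite (darts T)" using assms(1) by (simp add: strands_def finite_darts)
  with sub have fin: "finite ?K" by (rule finite_subset)
  have closed: "g y \<in> ?K" if "y \<in> ?K" "g \<in> {edge T, thru T}" for g y
  proof -
    have "(y, g y) \<in> strand_rel T" using that sub strand_rel_edge strand_rel_thru by blast
    with that(1) show ?thesis by (auto simp: component_def intro: rtrancl_into_rtrancl)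
  qed
  have "even (card {y \<in> ?K. edge T y \<noteq> y})"
    using fin by (rule even_card_moved) (use closed sub assms(1) in \<open>auto simp: strands_def\<close>)
  moreover have "{y \<in> ?K. edge T y \<noteq> y} = ?K"
    using sub assms(1) by (auto simp: strands_def)
  ultimately have "even (card ?K)" by simp
  moreover have "even (card {y \<in> ?K. thru T y \<noteq> y})"
    using fin by (rule even_card_moved) (use closed sub in \<open>auto simp: thru_thru\<close>)
  moreover have "{y \<in> ?K. thru T y \<noteq> y} = ?K - end_dart ` {1..4}"
    using sub terminal_dart[OF assms(1)] thru_fixed_iff by blast
  ultimately show ?thesis
    using card_Int_Diff[OF fin, of "end_dart ` {1..4}"] by simp
qed

section \<open>Pairings of the four endpoints\<close>

definition linkage :: "'c tvert diagram \<Rightarrow> (nat \<times> nat) set" where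
  "linkage T = linked (strand_rel T) end_dart {1..4}"

text \<open>Pairings are encoded as equivalence relations: \<open>blocks 1 2 3 4\<close>,
  \<open>blocks 1 4 2 3\<close> and \<open>blocks 1 3 2 4\<close> are the pairings
  \<open>m\<^sub>1\<close>, \<open>m\<^sub>2\<close> and \<open>m\<^sub>3\<close>.\<close>

definition blocks :: "nat \<Rightarrow> nat \<Rightarrow> nat \<Rightarrow> nat \<Rightarrow> (nat \<times> nat) set" where
  "blocks a b c d = {a, b} \<times> {a, b} \<union> {c, d} \<times> {c, d}"

text \<open>
  Only the parity of the blocks of a linkage is proved. The last partition, which never
  occurs for an actual tangle, is invariant under rotation and does no harm.
\<close>

definition even_partitions :: "(nat \<times> nat) set set" where
  "even_partitions = {blocks 1 2 3 4, blocks 1 4 2 3, blocks 1 3 2 4, {1..4} \<times> {1..4}}"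

lemma atLeastAtMost_1_4: "{1..4} = {1, 2, 3, 4 :: nat}"
  by auto

text \<open>Classes of even size on four points leave only two classes of size two or a single class
  of size four. The proof reduces this to a check on the six pairs of distinct indices.\<close>

lemma even_partitionsI:
  assumes E: "E \<subseteq> {1..4} \<times> {1..4}" "refl_on {1..4} E" "sym E" "trans E"
    and even: "\<And>i. i \<in> {1..4} \<Longrightarrow> even (card (E `` {i}))"
  shows "E \<in> even_partitions"
proof -
  have sum: "even (of_bool ((i, 1) \<in> E) + of_bool ((i, 2) \<in> E) + of_bool ((i, 3) \<in> E) +
      of_bool ((i, 4) \<in> E) :: nat)" if "i \<in> {1..4}" for i
  proof -
    have "E `` {i} = {1, 2, 3, 4} \<inter> {j. (i, j) \<in> E}"
      using E(1) by (auto simp: atLeastAtMost_1_4)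
    then have "card (E `` {i}) = (\<Sum>j\<in>{1, 2, 3, 4}. of_bool ((i, j) \<in> E))"
      by (simp only: sum_of_bool_eq finite_insert finite.emptyI of_nat_id)
    also have "\<dots> = of_bool ((i, 1) \<in> E) + of_bool ((i, 2) \<in> E) + of_bool ((i, 3) \<in> E) +
      of_bool ((i, 4) \<in> E)"
      by (simp del: sum_of_bool_eq)
    finally show ?thesis using even[OF that] by simp
  qed
  have refl: "(1, 1) \<in> E" "(2, 2) \<in> E" "(3, 3) \<in> E" "(4, 4) \<in> E"
    using E(2) by (auto simp: refl_on_def)
  have sym: "(2, 1) \<in> E \<longleftrightarrow> (1, 2) \<in> E" "(3, 1) \<in> E \<longleftrightarrow> (1, 3) \<in> E" "(4, 1) \<in> E \<longleftrightarrow> (1, 4) \<in> E"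
    "(3, 2) \<in> E \<longleftrightarrow> (2, 3) \<in> E" "(4, 2) \<in> E \<longleftrightarrow> (2, 4) \<in> E" "(4, 3) \<in> E \<longleftrightarrow> (3, 4) \<in> E"
    using E(3) by (blast dest: symD)+
  have trans: "(1, 2) \<in> E \<Longrightarrow> (1, 3) \<in> E \<Longrightarrow> (2, 3) \<in> E"
    "(1, 2) \<in> E \<Longrightarrow> (1, 4) \<in> E \<Longrightarrow> (2, 4) \<in> E"
    "(1, 3) \<in> E \<Longrightarrow> (1, 4) \<in> E \<Longrightarrow> (3, 4) \<in> E"
    "(1, 2) \<in> E \<Longrightarrow> (2, 3) \<in> E \<Longrightarrow> (1, 3) \<in> E"
    "(1, 3) \<in> E \<Longrightarrow> (3, 4) \<in> E \<Longrightarrow> (1, 4) \<in> E"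
    "(1, 4) \<in> E \<Longrightarrow> (2, 4) \<in> E \<Longrightarrow> (1, 2) \<in> E"
    using sym E(4) by (blast dest: transD)+
  \<comment> \<open>Each index is related to itself, so it must be related to an odd number of the
    other three; nested equivalences express this odd parity.\<close>
  have parity: "(1, 2) \<in> E \<longleftrightarrow> ((1, 3) \<in> E \<longleftrightarrow> (1, 4) \<in> E)"
    "(1, 2) \<in> E \<longleftrightarrow> ((2, 3) \<in> E \<longleftrightarrow> (2, 4) \<in> E)"
    "(1, 3) \<in> E \<longleftrightarrow> ((2, 3) \<in> E \<longleftrightarrow> (3, 4) \<in> E)"
    using sum[of 1] sum[of 2] sum[of 3] refl by (auto simp: sym of_bool_def simp del: One_nat_def split: if_splits)
  have eq: "E = F" if "\<forall>i\<in>{1, 2, 3, 4}. \<forall>j\<in>{1, 2, 3, 4}. (i, j) \<in> E \<longleftrightarrow> (i, j) \<in> F"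
    "F \<subseteq> {1, 2, 3, 4} \<times> {1, 2, 3, 4}" for F
    using that E(1) unfolding atLeastAtMost_1_4 by blast
  have "((1, 2) \<in> E \<and> (3, 4) \<in> E \<and> (1, 3) \<notin> E \<and> (1, 4) \<notin> E \<and> (2, 3) \<notin> E \<and> (2, 4) \<notin> E) \<or>
    ((1, 4) \<in> E \<and> (2, 3) \<in> E \<and> (1, 2) \<notin> E \<and> (1, 3) \<notin> E \<and> (2, 4) \<notin> E \<and> (3, 4) \<notin> E) \<or>
    ((1, 3) \<in> E \<and> (2, 4) \<in> E \<and> (1, 2) \<notin> E \<and> (1, 4) \<notin> E \<and> (2, 3) \<notin> E \<and> (3, 4) \<notin> E) \<or>
    ((1, 2) \<in> E \<and> (3, 4) \<in> E \<and> (1, 3) \<in> E \<and> (1, 4) \<in> E \<and> (2, 3) \<in> E \<and> (2, 4) \<in> E)"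
    using parity trans
    by (cases "(1, 2) \<in> E"; cases "(1, 3) \<in> E"; cases "(1, 4) \<in> E"; cases "(2, 3) \<in> E";
        cases "(2, 4) \<in> E"; cases "(3, 4) \<in> E"; simp)
  then show ?thesis
  proof (elim disjE)
    assume "(1, 2) \<in> E \<and> (3, 4) \<in> E \<and> (1, 3) \<notin> E \<and> (1, 4) \<notin> E \<and> (2, 3) \<notin> E \<and> (2, 4) \<notin> E"
    then have "E = blocks 1 2 3 4"
      by (intro eq) (simp_all add: blocks_def refl sym del: One_nat_def)
    then show ?thesis by (simp add: even_partitions_def)
  next
    assume "(1, 4) \<in> E \<and> (2, 3) \<in> E \<and> (1, 2) \<notin> E \<and> (1, 3) \<notin> E \<and> (2, 4) \<notin> E \<and> (3, 4) \<notin> E"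
    then have "E = blocks 1 4 2 3"
      by (intro eq) (simp_all add: blocks_def refl sym del: One_nat_def)
    then show ?thesis by (simp add: even_partitions_def)
  next
    assume "(1, 3) \<in> E \<and> (2, 4) \<in> E \<and> (1, 2) \<notin> E \<and> (1, 4) \<notin> E \<and> (2, 3) \<notin> E \<and> (3, 4) \<notin> E"
    then have "E = blocks 1 3 2 4"
      by (intro eq) (simp_all add: blocks_def refl sym del: One_nat_def)
    then show ?thesis by (simp add: even_partitions_def)
  next
    assume "(1, 2) \<in> E \<and> (3, 4) \<in> E \<and> (1, 3) \<in> E \<and> (1, 4) \<in> E \<and> (2, 3) \<in> E \<and> (2, 4) \<in> E"
    then have "E = {1..4} \<times> {1..4}"
      by (intro eq) (simp_all add: atLeastAtMost_1_4 refl sym del: One_nat_def)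
    then show ?thesis by (simp add: even_partitions_def)
  qed
qed

text \<open>Distinct endpoints have distinct darts, so the size of a class is the number of
  endpoints on one component, which is even by \<open>even_ends\<close>.\<close>

lemma linkage_even_partition:
  assumes "strands T"
  shows "linkage T \<in> even_partitions"
proof (rule even_partitionsI)
  show "linkage T \<subseteq> {1..4} \<times> {1..4}" "refl_on {1..4} (linkage T)"
    by (auto simp: linkage_def linked_def refl_on_def)
  show "sym (linkage T)"
    unfolding linkage_def by (rule linked_sym[OF strand_rel_sym[OF assms]])
  show "trans (linkage T)"
    by (rule transI) (auto simp: linkage_def linked_def)
  fix i :: nat assume i: "i \<in> {1..4}"
  have "end_dart ` (linkage T `` {i}) = component (strand_rel T) (end_dart i) \<inter> end_dart ` {1..4}"
    using i by (auto simp: linkage_def linked_def component_def)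
  moreover have "inj (end_dart :: nat \<Rightarrow> 'a tvert \<times> nat)" by (auto simp: inj_on_def end_dart_def)
  ultimately show "even (card (linkage T `` {i}))"
    using even_ends[OF assms, of "end_dart i"] i end_dart_in_darts[OF assms]
    by (metis card_image inj_on_subset subset_UNIV)
qed


section \<open>Joins of even partitions\<close>

text \<open>The number of blocks of the join of two partitions: the join is generated by the union
  of the relations.\<close>

definition join_count :: "(nat \<times> nat) set \<Rightarrow> (nat \<times> nat) set \<Rightarrow> nat" where
  "join_count E F = card (component (E \<union> F) ` {1..4})"

text \<open>The place \<open>i\<close> is taken after the turn by the former endpoint
  \<open>pred4 i\<close>. The range is restricted because \<open>pred4\<close> maps both 1 and 5 to
  4.\<close>

definition rotated :: "(nat \<times> nat) set \<Rightarrow> (nat \<times> nat) set" where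
  "rotated E = {(i, j). i \<in> {1..4} \<and> j \<in> {1..4} \<and> (pred4 i, pred4 j) \<in> E}"

text \<open>The coefficients of the linear form \<open>a\<^sub>1 - a\<^sub>2\<close>; multiplied by
  \<open>d - 1\<close> they are the difference of the rows of \<open>m\<^sub>1\<close> and
  \<open>m\<^sub>2\<close> in the matrix of the pairing.\<close>

definition planar_sign :: "(nat \<times> nat) set \<Rightarrow> laurent" where
  "planar_sign E = (if E = blocks 1 2 3 4 then 1 else if E = blocks 1 4 2 3 then -1 else 0)"

lemma card_components_connected:
  assumes "sym r" "{1..4} = {a, b, c, d}" "(a, b) \<in> r" "(c, d) \<in> r" "(a, c) \<in> r"
  shows "card (component r ` {1..4 :: nat}) = 1"
proof -
  have "component r a = component r b" "component r c = component r d" "component r a = component r c"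
    using assms(3-5) by (simp_all add: component_eq_iff[OF assms(1)] r_into_rtrancl)
  then have "component r ` {1..4} = {component r a}" unfolding assms(2) by auto
  then show ?thesis by simp
qed

lemma sym_blocks: "sym (blocks a b c d)"
  by (auto simp: blocks_def sym_def)

lemma card_components_blocks:
  assumes "{1..4} = {a, b, c, d}" "distinct [a, b, c, d]"
  shows "card (component (blocks a b c d) ` {1..4}) = 2"
proof -
  have "trans (A \<times> A \<union> B \<times> B)" if "A \<inter> B = {}" for A B :: "nat set"
    using that by (auto simp: trans_def)
  moreover have "{a, b} \<inter> {c, d} = {}" using assms(2) by auto
  ultimately have "trans (blocks a b c d)" unfolding blocks_def by blast
  then have "(blocks a b c d)\<^sup>* = (blocks a b c d)\<^sup>=" by (metis reflcl_trancl trancl_id)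
  then have *: "component (blocks a b c d) x = insert x (blocks a b c d `` {x})" for x
    by (auto simp: component_def)
  have "blocks a b c d `` {a} = {a, b}" "blocks a b c d `` {b} = {a, b}"
    "blocks a b c d `` {c} = {c, d}" "blocks a b c d `` {d} = {c, d}"
    using assms(2) by (auto simp: blocks_def)
  then have "component (blocks a b c d) ` {1..4} = {{a, b}, {c, d}}"
    unfolding assms(1) by (simp add: * insert_absorb)
  moreover have "{a, b} \<noteq> {c, d}" using assms(2) by auto
  ultimately show ?thesis by simp
qed

lemma join_count_commute: "join_count E F = join_count F E"
  by (simp add: join_count_def Un_commute)

lemma even_partition_cases:
  assumes "E \<in> even_partitions"
  obtains "E = blocks 1 2 3 4" | "E = blocks 1 4 2 3" | "E = blocks 1 3 2 4" | "E = {1..4} \<times> {1..4}"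
  using assms by (auto simp: even_partitions_def)

lemma blocks_distinct:
  "blocks 1 2 3 4 \<noteq> blocks 1 4 2 3" "blocks 1 2 3 4 \<noteq> blocks 1 3 2 4" "blocks 1 4 2 3 \<noteq> blocks 1 3 2 4"
  "{1..4} \<times> {1..4} \<noteq> blocks 1 2 3 4" "{1..4} \<times> {1..4} \<noteq> blocks 1 4 2 3"
proof -
  have "(1, 2) \<in> blocks 1 2 3 4" "(1, 2) \<notin> blocks 1 4 2 3" "(1, 2) \<notin> blocks 1 3 2 4"
    "(1, 3) \<notin> blocks 1 2 3 4" "(1, 3) \<notin> blocks 1 4 2 3" "(1, 3) \<in> blocks 1 3 2 4"
    "(1, 3) \<in> {1..4 :: nat} \<times> {1..4 :: nat}"
    by (auto simp: blocks_def)
  then show "blocks 1 2 3 4 \<noteq> blocks 1 4 2 3" "blocks 1 2 3 4 \<noteq> blocks 1 3 2 4"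
    "blocks 1 4 2 3 \<noteq> blocks 1 3 2 4" "{1..4} \<times> {1..4} \<noteq> blocks 1 2 3 4"
    "{1..4} \<times> {1..4} \<noteq> blocks 1 4 2 3"
    by metis+
qed

text \<open>Only joins with \<open>m\<^sub>1\<close> or \<open>m\<^sub>2\<close> are computed: a
  partition fixed by the rotation contributes two equal terms, which cancel.\<close>

lemma join_count_values:
  "join_count (blocks 1 2 3 4) (blocks 1 2 3 4) = 2"
  "join_count (blocks 1 4 2 3) (blocks 1 4 2 3) = 2"
  "join_count (blocks 1 2 3 4) (blocks 1 4 2 3) = 1"
  "join_count (blocks 1 2 3 4) (blocks 1 3 2 4) = 1"
  "join_count (blocks 1 4 2 3) (blocks 1 3 2 4) = 1"
  "join_count (blocks 1 2 3 4) ({1..4} \<times> {1..4}) = 1"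
  "join_count (blocks 1 4 2 3) ({1..4} \<times> {1..4}) = 1"
proof -
  have sym4: "sym ({1..4 :: nat} \<times> {1..4})" by (auto simp: sym_def)
  show "join_count (blocks 1 2 3 4) (blocks 1 2 3 4) = 2" "join_count (blocks 1 4 2 3) (blocks 1 4 2 3) = 2"
    unfolding join_count_def Un_absorb by (rule card_components_blocks; force)+
  show "join_count (blocks 1 2 3 4) (blocks 1 4 2 3) = 1"
    unfolding join_count_def
    by (rule card_components_connected[of _ 1 2 4 3, OF sym_Un[OF sym_blocks sym_blocks]]) (auto simp: blocks_def)
  show "join_count (blocks 1 2 3 4) (blocks 1 3 2 4) = 1"
    unfolding join_count_def
    by (rule card_components_connected[of _ 1 2 3 4, OF sym_Un[OF sym_blocks sym_blocks]]) (auto simp: blocks_def)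
  show "join_count (blocks 1 4 2 3) (blocks 1 3 2 4) = 1"
    unfolding join_count_def
    by (rule card_components_connected[of _ 1 4 3 2, OF sym_Un[OF sym_blocks sym_blocks]]) (auto simp: blocks_def)
  show "join_count (blocks 1 2 3 4) ({1..4} \<times> {1..4}) = 1" "join_count (blocks 1 4 2 3) ({1..4} \<times> {1..4}) = 1"
    unfolding join_count_def
    by (rule card_components_connected[of _ 1 2 3 4, OF sym_Un[OF sym_blocks sym4]]; auto)+
qed

lemma rotated_values:
  "rotated (blocks 1 2 3 4) = blocks 1 4 2 3"
  "rotated (blocks 1 4 2 3) = blocks 1 2 3 4"
  "rotated (blocks 1 3 2 4) = blocks 1 3 2 4"
  "rotated ({1..4} \<times> {1..4}) = {1..4} \<times> {1..4}"
proof -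
  have eq: "rotated E = F" if "F \<subseteq> {1, 2, 3, 4} \<times> {1, 2, 3, 4}"
    "\<forall>i\<in>{1, 2, 3, 4}. \<forall>j\<in>{1, 2, 3, 4}. (pred4 i, pred4 j) \<in> E \<longleftrightarrow> (i, j) \<in> F" for E F
    using that unfolding rotated_def atLeastAtMost_1_4 by blast
  show "rotated (blocks 1 2 3 4) = blocks 1 4 2 3" "rotated (blocks 1 4 2 3) = blocks 1 2 3 4"
    "rotated (blocks 1 3 2 4) = blocks 1 3 2 4" "rotated ({1..4} \<times> {1..4}) = {1..4} \<times> {1..4}"
    by (rule eq; simp add: blocks_def atLeastAtMost_1_4 del: One_nat_def)+
qed

lemmas partition_simps = join_count_values join_count_values(3-7)[THEN trans[OF join_count_commute]]
  rotated_values blocks_distinct blocks_distinct[symmetric]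

text \<open>The contribution of one pair of states, with \<open>n\<close> closed loops inside the
  tangles. The sign changes when \<open>E\<close> or \<open>F\<close> passes from
  \<open>m\<^sub>1\<close> to \<open>m\<^sub>2\<close>, so the right side factors; every join has a
  block, so the subtraction of 1 is not truncated.\<close>

lemma loop_power_rotated:
  assumes "E \<in> even_partitions" "F \<in> even_partitions"
  shows "loop_value ^ (n + join_count E F - 1) - loop_value ^ (n + join_count (rotated E) F - 1) =
    loop_value ^ n * (planar_sign E * planar_sign F * (loop_value - 1))"
  using assms(1) by (cases rule: even_partition_cases; use assms(2) in \<open>cases rule: even_partition_cases\<close>)
    (simp_all add: partition_simps planar_sign_def algebra_simps del: One_nat_def)

lemma loop_power_closed:
  assumes "E \<in> even_partitions"
  shows "loop_value ^ (n + join_count E (blocks 1 2 3 4) - 1) - loop_value ^ (n + join_count E (blocks 1 4 2 3) - 1) =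
    loop_value ^ n * (planar_sign E * (loop_value - 1))"
  using assms by (cases rule: even_partition_cases)
    (simp_all add: partition_simps planar_sign_def algebra_simps del: One_nat_def)


section \<open>Gluing\<close>

definition loops :: "'c tvert diagram \<Rightarrow> nat" where
  "loops T = card (free_components (strand_rel T) (darts T) (end_dart ` {1..4}))"

lemma dart_cases:
  assumes "strands T" "x \<in> darts T"
  obtains (terminal) i where "i \<in> {1..4}" "x = end_dart i"
    | (inner) c k where "x = (Inner c, k)" "Inner c \<in> verts T" "k < valence (kind T (Inner c))"
      "kind T (Inner c) \<noteq> Terminal"
proof (cases x)
  case (Pair v k)
  with assms(2) have v: "v \<in> verts T" "k < valence (kind T v)" by (auto simp: darts_def)
  show ?thesis
  proof (cases v)
    case (Endpoint i)
    with v assms(1) have "i \<in> {1..4}" "kind T v = Terminal" unfolding strands_def by blast+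
    with v Pair Endpoint show ?thesis by (intro terminal) (simp_all add: end_dart_def)
  next
    case (Inner c)
    with v assms(1) have "kind T (Inner c) \<noteq> Terminal" unfolding strands_def by blast
    with v Pair Inner show ?thesis by (intro inner) simp_all
  qed
qed

lemma inj_in_dart:
  assumes "strands T"
  shows "inj_on in_dart (darts T)"
proof (rule inj_onI)
  fix x y assume "x \<in> darts T" "y \<in> darts T" "in_dart x = in_dart y"
  then show "x = y"
    by (cases rule: dart_cases[OF assms \<open>x \<in> darts T\<close>]; cases rule: dart_cases[OF assms \<open>y \<in> darts T\<close>])
      (simp_all add: end_dart_def)
qed

lemma inj_out_dart:
  assumes "strands T"
  shows "inj_on out_dart (darts T)"
proof (rule inj_onI)
  fix x y assume "x \<in> darts T" "y \<in> darts T" "out_dart x = out_dart y"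
  then show "x = y"
    by (cases rule: dart_cases[OF assms \<open>x \<in> darts T\<close>]; cases rule: dart_cases[OF assms \<open>y \<in> darts T\<close>])
      (simp_all add: end_dart_def)
qed

lemma in_out_disjoint:
  assumes "strands T" "strands T'"
  shows "in_dart ` darts T \<inter> out_dart ` darts T' = {}"
proof -
  have "in_dart x \<noteq> out_dart y" if "x \<in> darts T" "y \<in> darts T'" for x y
    using assms(1) that(1)
    by (rule dart_cases; use assms(2) that(2) in \<open>rule dart_cases\<close>) (auto simp: end_dart_def)
  then show ?thesis by blast
qed

lemma darts_glue:
  assumes "strands T" "strands T'"
  shows "darts (glue T T') = in_dart ` darts T \<union> out_dart ` darts T'"
proof
  have ends: "end_dart i \<in> darts T" "end_dart i \<in> darts T'" if "i \<in> {1..4}" for i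
    using that assms by (simp_all add: end_dart_in_darts)
  show "darts (glue T T') \<subseteq> in_dart ` darts T \<union> out_dart ` darts T'"
  proof
    fix x assume "x \<in> darts (glue T T')"
    then obtain v k where x: "x = (v, k)" "v \<in> verts (glue T T')" "k < valence (glue_kind T T' v)"
      by (auto simp: darts_def glue_def)
    show "x \<in> in_dart ` darts T \<union> out_dart ` darts T'"
    proof (cases v)
      case (Inside c)
      with x have "(Inner c, k) \<in> darts T" by (auto simp: darts_def glue_def)
      then show ?thesis using x Inside by (auto intro: rev_image_eqI)
    next
      case (Outside d)
      with x have "(Inner d, k) \<in> darts T'" by (auto simp: darts_def glue_def)
      then show ?thesis using x Outside by (auto intro: rev_image_eqI)
    next
      case (Seam i)
      with x have i: "i \<in> {1..4}" and "k = 0 \<or> k = 1" by (auto simp: glue_def)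
      then have "x = in_dart (end_dart i) \<or> x = out_dart (end_dart i)"
        using x Seam by (auto simp: end_dart_def)
      with ends[OF i] show ?thesis by blast
    qed
  qed
  have "in_dart x \<in> darts (glue T T')" if "x \<in> darts T" for x
    using assms(1) that by (rule dart_cases) (auto simp: darts_def glue_def end_dart_def)
  moreover have "out_dart x \<in> darts (glue T T')" if "x \<in> darts T'" for x
    using assms(2) that by (rule dart_cases) (auto simp: darts_def glue_def end_dart_def)
  ultimately show "in_dart ` darts T \<union> out_dart ` darts T' \<subseteq> darts (glue T T')" by blast
qed

lemma edge_glue:
  "strands T \<Longrightarrow> x \<in> darts T \<Longrightarrow> edge (glue T T') (in_dart x) = in_dart (edge T x)"
  "strands T' \<Longrightarrow> y \<in> darts T' \<Longrightarrow> edge (glue T T') (out_dart y) = out_dart (edge T' y)"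
  by (erule (1) dart_cases; simp add: glue_def end_dart_def)+

lemma thru_glue:
  "strands T \<Longrightarrow> x \<in> darts T \<Longrightarrow> x \<notin> end_dart ` {1..4} \<Longrightarrow>
    thru (glue T T') (in_dart x) = in_dart (thru T x)"
  "strands T' \<Longrightarrow> y \<in> darts T' \<Longrightarrow> y \<notin> end_dart ` {1..4} \<Longrightarrow>
    thru (glue T T') (out_dart y) = out_dart (thru T' y)"
  by (erule (1) dart_cases; simp add: thru_def glue_def end_dart_def)+

text \<open>Within a tangle \<open>thru\<close> fixes the dart at an endpoint, but in the glued
  diagram it crosses to the other tangle. These are the seam edges of \<open>bridge\<close>.\<close>

lemma thru_glue_seam:
  "thru (glue T T') (in_dart (end_dart i)) = out_dart (end_dart i)"
  "thru (glue T T') (out_dart (end_dart i)) = in_dart (end_dart i)"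
  by (simp_all add: thru_def glue_def end_dart_def)

lemma thru_end: "strands T \<Longrightarrow> i \<in> {1..4} \<Longrightarrow> thru T (end_dart i) = end_dart i"
  by (simp add: thru_fixed_iff end_dart_in_darts terminal_dart)

text \<open>Only the closures agree: the bridge also contains the reflexive pairs that
  \<open>thru\<close> produces at the endpoints of the separate tangles.\<close>

lemma rtrancl_strand_rel_glue:
  assumes "strands T" "strands T'"
  shows "(strand_rel (glue T T'))\<^sup>* =
    (bridge (strand_rel T) end_dart in_dart (strand_rel T') end_dart out_dart {1..4})\<^sup>*" (is "?G\<^sup>* = ?B\<^sup>*")
proof (rule rtrancl_subset[symmetric])
  have in_B: "(in_dart x, in_dart y) \<in> ?B" if "(x, y) \<in> strand_rel T" for x y
    using that by (force simp: bridge_def)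
  have out_B: "(out_dart x, out_dart y) \<in> ?B" if "(x, y) \<in> strand_rel T'" for x y
    using that by (force simp: bridge_def)
  have seam_B: "(in_dart (end_dart i), out_dart (end_dart i)) \<in> ?B"
    "(out_dart (end_dart i), in_dart (end_dart i)) \<in> ?B" if "i \<in> {1..4}" for i
    using that unfolding bridge_def by blast+
  note in_darts = darts_glue[OF assms]
  show "?G \<subseteq> ?B"
  proof (rule subrelI)
    fix u w assume uw: "(u, w) \<in> ?G"
    then have "u \<in> darts (glue T T')" by (auto elim: strand_relE)
    then consider (L) x where "x \<in> darts T" "u = in_dart x" | (R) x where "x \<in> darts T'" "u = out_dart x"
      unfolding in_darts by blast
    then show "(u, w) \<in> ?B"
    proof cases
      case L
      from uw show ?thesis
      proof (cases rule: strand_relE)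
        case edge
        with L show ?thesis by (simp add: edge_glue assms in_B strand_rel_edge del: One_nat_def)
      next
        case thru
        with L show ?thesis
          by (cases "x \<in> end_dart ` {1..4}")
            (auto simp: thru_glue thru_glue_seam assms seam_B simp del: One_nat_def intro!: in_B strand_rel_thru)
      qed
    next
      case R
      from uw show ?thesis
      proof (cases rule: strand_relE)
        case edge
        with R show ?thesis by (simp add: edge_glue assms out_B strand_rel_edge del: One_nat_def)
      next
        case thru
        with R show ?thesis
          by (cases "x \<in> end_dart ` {1..4}")
            (auto simp: thru_glue thru_glue_seam assms seam_B simp del: One_nat_def intro!: out_B strand_rel_thru)
      qed
    qed
  qed
  have G: "(u, edge (glue T T') u) \<in> ?G" "(u, thru (glue T T') u) \<in> ?G"
    if "u \<in> in_dart ` darts T \<union> out_dart ` darts T'" for u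
    using that unfolding in_darts[symmetric] by (simp_all add: strand_rel_edge strand_rel_thru)
  have in_G: "(in_dart x, in_dart y) \<in> ?G\<^sup>*" if "(x, y) \<in> strand_rel T" for x y
    using that
  proof (cases rule: strand_relE)
    case edge
    then show ?thesis using G(1)[of "in_dart x"] assms by (simp add: edge_glue)
  next
    case thru
    then show ?thesis using G(2)[of "in_dart x"] assms
      by (cases "x \<in> end_dart ` {1..4}") (auto simp: thru_glue thru_end)
  qed
  have out_G: "(out_dart x, out_dart y) \<in> ?G\<^sup>*" if "(x, y) \<in> strand_rel T'" for x y
    using that
  proof (cases rule: strand_relE)
    case edge
    then show ?thesis using G(1)[of "out_dart x"] assms by (simp add: edge_glue)
  next
    case thru
    then show ?thesis using G(2)[of "out_dart x"] assms
      by (cases "x \<in> end_dart ` {1..4}") (auto simp: thru_glue thru_end)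
  qed
  have seam_G: "(in_dart (end_dart i), out_dart (end_dart i)) \<in> ?G\<^sup>*"
    "(out_dart (end_dart i), in_dart (end_dart i)) \<in> ?G\<^sup>*" if "i \<in> {1..4}" for i
    using G(2)[of "in_dart (end_dart i)"] G(2)[of "out_dart (end_dart i)"] that assms
    by (auto simp: thru_glue_seam end_dart_in_darts)
  show "?B \<subseteq> ?G\<^sup>*"
    using in_G out_G seam_G unfolding bridge_def by auto
qed

lemma curves_glue:
  assumes "strands T" "strands T'"
  shows "curves (glue T T') = loops T + loops T' + join_count (linkage T) (linkage T')"
proof -
  interpret gluing "darts T" "strand_rel T" end_dart in_dart
    "darts T'" "strand_rel T'" end_dart out_dart "{1..4}"
    using assms
    by unfold_locales
      (simp_all add: strands_def[of T] strands_def[of T'] finite_darts strand_rel_field strand_rel_sym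
        inj_in_dart inj_out_dart in_out_disjoint image_subset_iff end_dart_in_darts)
  show ?thesis
    using card_components
    unfolding curves_eq_components darts_glue[OF assms] component_def[abs_def] rtrancl_strand_rel_glue[OF assms]
    by (simp add: loops_def join_count_def linkage_def component_def[abs_def])
qed


section \<open>Rotation\<close>

lemma succ4_in: "i \<in> {1..4} \<Longrightarrow> succ4 i \<in> {1..4}"
  and pred4_in: "i \<in> {1..4} \<Longrightarrow> pred4 i \<in> {1..4}"
  and pred4_succ4: "i \<in> {1..4} \<Longrightarrow> pred4 (succ4 i) = i"
  and succ4_pred4: "i \<in> {1..4} \<Longrightarrow> succ4 (pred4 i) = i"
  by auto

lemma darts_rho: "darts (rho T) = darts T"
  and thru_rho: "thru (rho T) = thru T"
  by (simp_all add: darts_def thru_def rho_def)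

lemma turn_end: "turn p (end_dart i) = end_dart (p i)"
  by (simp add: end_dart_def)

context
  fixes T :: "'c tvert diagram"
  assumes T: "strands T"
begin

lemma turn_darts: "x \<in> darts T \<Longrightarrow> turn succ4 x \<in> darts T"
  by (rule dart_cases[OF T], assumption)
    (simp_all add: turn_end end_dart_in_darts[OF T] succ4_in
      del: One_nat_def atLeastAtMost_iff succ4.simps pred4.simps)

lemma turn_darts': "x \<in> darts T \<Longrightarrow> turn pred4 x \<in> darts T"
  by (rule dart_cases[OF T], assumption)
    (simp_all add: turn_end end_dart_in_darts[OF T] pred4_in
      del: One_nat_def atLeastAtMost_iff succ4.simps pred4.simps)

lemma turn_turn: "x \<in> darts T \<Longrightarrow> turn pred4 (turn succ4 x) = x"
  by (rule dart_cases[OF T], assumption)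
    (simp_all add: turn_end pred4_succ4
      del: One_nat_def atLeastAtMost_iff succ4.simps pred4.simps)

lemma turn_turn': "x \<in> darts T \<Longrightarrow> turn succ4 (turn pred4 x) = x"
  by (rule dart_cases[OF T], assumption)
    (simp_all add: turn_end succ4_pred4
      del: One_nat_def atLeastAtMost_iff succ4.simps pred4.simps)

lemma thru_turn: "x \<in> darts T \<Longrightarrow> thru T (turn succ4 x) = turn succ4 (thru T x)"
  by (rule dart_cases[OF T], assumption)
    (simp_all add: turn_end thru_end[OF T] succ4_in del: One_nat_def atLeastAtMost_iff succ4.simps, simp add: thru_def)

lemma edge_rho: "x \<in> darts T \<Longrightarrow> edge (rho T) (turn succ4 x) = turn succ4 (edge T x)"
  by (simp add: rho_def turn_turn)

lemma strands_rho: "strands (rho T)"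
proof -
  have "edge (rho T) x \<in> darts T \<and> edge (rho T) x \<noteq> x \<and> edge (rho T) (edge (rho T) x) = x"
    if x: "x \<in> darts T" for x
  proof -
    let ?y = "turn pred4 x"
    have y: "?y \<in> darts T" "x = turn succ4 ?y" using x by (simp_all add: turn_darts' turn_turn')
    have e: "edge T ?y \<in> darts T" "edge T ?y \<noteq> ?y" "edge T (edge T ?y) = ?y"
      using T y(1) by (auto simp: strands_def)
    have "edge (rho T) x = turn succ4 (edge T ?y)" using edge_rho[OF y(1)] y(2) by simp
    moreover have "turn succ4 (edge T ?y) \<noteq> x"
      using e y turn_turn by metis
    ultimately show ?thesis using e y by (simp add: turn_darts edge_rho)
  qed
  then show ?thesis using T unfolding strands_def darts_rho by (simp add: rho_def)
qed

text \<open>\<open>turn succ4\<close> is an isomorphism from the strands of \<open>T\<close> to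
  those of \<open>rho T\<close>, because \<open>rho\<close> conjugates \<open>edge\<close> by the
  turn while \<open>thru\<close> commutes with it.\<close>

lemma strand_rel_rho: "strand_rel (rho T) = map_prod (turn succ4) (turn succ4) ` strand_rel T"
proof
  have *: "(turn succ4 x, turn succ4 (edge T x)) \<in> strand_rel (rho T)"
    "(turn succ4 x, turn succ4 (thru T x)) \<in> strand_rel (rho T)" if "x \<in> darts T" for x
    using strand_rel_edge[of "turn succ4 x" "rho T"] strand_rel_thru[of "turn succ4 x" "rho T"] that
    by (simp_all add: darts_rho thru_rho turn_darts edge_rho thru_turn)
  then show "map_prod (turn succ4) (turn succ4) ` strand_rel T \<subseteq> strand_rel (rho T)"
    by (auto elim!: strand_relE)
  show "strand_rel (rho T) \<subseteq> map_prod (turn succ4) (turn succ4) ` strand_rel T"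
  proof (rule subrelI)
    fix u w assume uw: "(u, w) \<in> strand_rel (rho T)"
    then have u: "u \<in> darts T" by (auto simp: darts_rho elim: strand_relE)
    let ?y = "turn pred4 u"
    have y: "?y \<in> darts T" "turn succ4 ?y = u" using u by (simp_all add: turn_darts' turn_turn')
    have "w = turn succ4 (edge T ?y) \<or> w = turn succ4 (thru T ?y)"
      using uw edge_rho[OF y(1)] thru_turn[OF y(1)] y(2) by (auto simp: thru_rho elim!: strand_relE)
    then show "(u, w) \<in> map_prod (turn succ4) (turn succ4) ` strand_rel T"
      using strand_rel_edge[OF y(1)] strand_rel_thru[OF y(1)] y(2) by (force simp: map_prod_def)
  qed
qed

text \<open>The strand relation of \<open>T\<close> is kept and only its attaching maps are changed.
  The set of endpoints stays the same, hence so does the number of loops, while the linkage seen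
  from the seams is rotated.\<close>

lemma curves_glue_rho:
  assumes T': "strands T'"
  shows "curves (glue (rho T) T') = loops T + loops T' + join_count (rotated (linkage T)) (linkage T')"
proof -
  have inj_turn: "inj_on (turn succ4) (darts T)"
    by (rule inj_on_inverseI) (rule turn_turn)
  have turn_image: "turn succ4 ` darts T = darts T"
    using turn_darts turn_darts' turn_turn' by (metis image_subset_iff subsetI subset_antisym image_eqI)
  \<comment> \<open>Seam \<open>i\<close> meets the endpoint \<open>pred4 i\<close> of
    \<open>T\<close>, which the turn carries to place \<open>i\<close>. As \<open>?f\<close> turns a
    dart before embedding it, \<open>?f (?p i)\<close> is the seam dart.\<close>
  let ?p = "\<lambda>i. end_dart (pred4 i)" and ?f = "\<lambda>x. in_dart (turn succ4 x)"
  have image_f: "?f ` darts T = in_dart ` darts T"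
    using turn_image by (metis image_image)
  have p_darts: "?p ` {1..4} \<subseteq> darts T"
    by (rule image_subsetI) (simp only: end_dart_in_darts[OF T] pred4_in)
  have "inj_on ?f (darts T)"
    using comp_inj_on[OF inj_turn] inj_in_dart[OF T] by (simp add: turn_image comp_def)
  moreover have "finite (darts T)" "finite (darts T')"
    using T T' by (simp_all add: strands_def finite_darts)
  ultimately interpret gluing "darts T" "strand_rel T" ?p ?f
    "darts T'" "strand_rel T'" end_dart out_dart "{1..4}"
    using T T' p_darts in_out_disjoint[OF T T'] unfolding image_f[symmetric]
    by unfold_locales
      (simp_all add: strand_rel_field strand_rel_sym inj_out_dart image_subset_iff end_dart_in_darts)
  have p: "in_dart (end_dart i) = ?f (?p i)" if "i \<in> {1..4}" for i
    by (simp only: turn_end succ4_pred4[OF that])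
  have seams: "(\<lambda>i. (in_dart (end_dart i), out_dart (end_dart i))) ` {1..4} =
      (\<lambda>i. (?f (?p i), out_dart (end_dart i))) ` {1..4}"
    "(\<lambda>i. (out_dart (end_dart i), in_dart (end_dart i))) ` {1..4} =
      (\<lambda>i. (out_dart (end_dart i), ?f (?p i))) ` {1..4}"
    by (rule image_cong[OF refl], simp only: p)+
  have bridge: "bridge (strand_rel (rho T)) end_dart in_dart (strand_rel T') end_dart out_dart {1..4} =
      bridge (strand_rel T) ?p ?f (strand_rel T') end_dart out_dart {1..4}"
    unfolding bridge_def strand_rel_rho image_comp map_prod.comp by (simp only: comp_def seams)
  have ends: "?p ` {1..4} = end_dart ` {1..4}"
  proof
    show "?p ` {1..4} \<subseteq> end_dart ` {1..4}"
      by (rule image_subsetI) (rule imageI, rule pred4_in)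
    show "end_dart ` {1..4} \<subseteq> ?p ` {1..4}"
    proof (rule image_subsetI)
      fix i :: nat assume "i \<in> {1..4}"
      from imageI[OF succ4_in[OF this], of ?p] show "end_dart i \<in> ?p ` {1..4}"
        by (simp only: pred4_succ4[OF \<open>i \<in> {1..4}\<close>])
    qed
  qed
  have "linked (strand_rel T) ?p {1..4} = rotated (linkage T)"
    using pred4_in by (auto simp: linked_def rotated_def linkage_def simp del: pred4.simps One_nat_def)
  then show ?thesis
    using card_components
    unfolding curves_eq_components darts_glue[OF strands_rho T'] darts_rho component_def[abs_def]
      rtrancl_strand_rel_glue[OF strands_rho T'] bridge image_f ends
    by (simp add: loops_def join_count_def linkage_def[of T'] component_def[abs_def])
qed

end


section \<open>The bracket of a glued diagram\<close>

abbreviation in_vert :: "'c tvert \<Rightarrow> ('c, 'd) gvert" where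
  "in_vert v \<equiv> fst (in_dart (v, 0))"

abbreviation out_vert :: "'d tvert \<Rightarrow> ('c, 'd) gvert" where
  "out_vert v \<equiv> fst (out_dart (v, 0))"

lemma classical_inner:
  assumes "strands T" "v \<in> classical T"
  shows "\<exists>c. v = Inner c"
proof -
  from assms(2) have "v \<in> verts T" "kind T v \<noteq> Terminal" by (simp_all add: classical_def)
  with assms(1) have "\<nexists>i. v = Endpoint i" unfolding strands_def by blast
  then show ?thesis by (cases v) auto
qed

lemma classical_glue_iff:
  "Inside c \<in> classical (glue T T') \<longleftrightarrow> Inner c \<in> classical T"
  "Outside d \<in> classical (glue T T') \<longleftrightarrow> Inner d \<in> classical T'"
  "Seam i \<notin> classical (glue T T')"
  by (auto simp: classical_def glue_def)

lemma classical_glue: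
  assumes "strands T" "strands T'"
  shows "classical (glue T T') = in_vert ` classical T \<union> out_vert ` classical T'" (is "?A = ?B")
proof
  show "?A \<subseteq> ?B"
  proof
    fix v assume "v \<in> ?A"
    then show "v \<in> ?B"
      by (cases v) (force simp: classical_glue_iff)+
  qed
  show "?B \<subseteq> ?A"
  proof (intro Un_least image_subsetI)
    fix v assume v: "v \<in> classical T"
    with classical_inner[OF assms(1)] obtain c where "v = Inner c" by blast
    with v show "in_vert v \<in> ?A" by (simp add: classical_glue_iff)
  next
    fix v assume v: "v \<in> classical T'"
    with classical_inner[OF assms(2)] obtain d where "v = Inner d" by blast
    with v show "out_vert v \<in> ?A" by (simp add: classical_glue_iff)
  qed
qed

lemma inj_vert:
  assumes "strands T"
  shows "inj_on in_vert (classical T)" "inj_on out_vert (classical T)"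
proof -
  have "inj_on in_vert (range Inner)" "inj_on out_vert (range Inner)"
    by (simp_all add: inj_on_def)
  moreover have "classical T \<subseteq> range Inner" using classical_inner[OF assms] by blast
  ultimately show "inj_on in_vert (classical T)" "inj_on out_vert (classical T)"
    by (blast intro: inj_on_subset)+
qed

lemma in_out_vert_disjoint:
  assumes "strands T" "strands T'"
  shows "in_vert ` classical T \<inter> out_vert ` classical T' = {}"
proof -
  have "in_vert v \<noteq> out_vert w" if "v \<in> classical T" "w \<in> classical T'" for v w
    using classical_inner[OF assms(1) that(1)] classical_inner[OF assms(2) that(2)] by auto
  then show ?thesis by blast
qed

lemma resolve_glue:
  assumes "strands T" "strands T'" "\<sigma> \<subseteq> classical T" "\<tau> \<subseteq> classical T'"
  shows "resolve (glue T T') (in_vert ` \<sigma> \<union> out_vert ` \<tau>) = glue (resolve T \<sigma>) (resolve T' \<tau>)"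
proof -
  have \<sigma>: "\<exists>c. v = Inner c" if "v \<in> \<sigma>" for v using that assms classical_inner by blast
  have \<tau>: "\<exists>c. v = Inner c" if "v \<in> \<tau>" for v using that assms classical_inner by blast
  have in_iff: "Inside c \<in> in_vert ` \<sigma> \<union> out_vert ` \<tau> \<longleftrightarrow> Inner c \<in> \<sigma>" for c
    using \<sigma> \<tau> by force
  have out_iff: "Outside d \<in> in_vert ` \<sigma> \<union> out_vert ` \<tau> \<longleftrightarrow> Inner d \<in> \<tau>" for d
    using \<sigma> \<tau> by force
  have "kind (resolve (glue T T') (in_vert ` \<sigma> \<union> out_vert ` \<tau>)) v =
      kind (glue (resolve T \<sigma>) (resolve T' \<tau>)) v" for v
  proof (cases v)
    case (Inside c)
    show ?thesis using in_iff[of c] unfolding Inside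
      by (simp add: resolve_def classical_glue_iff) (simp add: glue_def)
  next
    case (Outside d)
    show ?thesis using out_iff[of d] unfolding Outside
      by (simp add: resolve_def classical_glue_iff) (simp add: glue_def)
  next
    case (Seam i)
    show ?thesis unfolding Seam
      by (simp add: resolve_def classical_glue_iff) (simp add: glue_def)
  qed
  moreover have "edge (glue (resolve T \<sigma>) (resolve T' \<tau>)) x = edge (glue T T') x" for x
    by (cases x; cases "fst x") (auto simp: glue_def resolve_def)
  ultimately show ?thesis
    by (intro diagram.equality ext) (auto simp: resolve_def glue_def)
qed

lemma darts_resolve: "darts (resolve T \<sigma>) = darts T"
proof -
  have "valence (kind (resolve T \<sigma>) v) = valence (kind T v)" for v
    by (auto simp: resolve_def classical_def)
  then show ?thesis by (simp add: darts_def) (simp add: resolve_def)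
qed

lemma strands_resolve:
  assumes "strands T"
  shows "strands (resolve T \<sigma>)"
proof -
  have "kind (resolve T \<sigma>) v = Terminal \<longleftrightarrow> kind T v = Terminal" for v
    by (auto simp: resolve_def classical_def)
  moreover have "edge (resolve T \<sigma>) = edge T" "verts (resolve T \<sigma>) = verts T"
    by (simp_all add: resolve_def)
  ultimately show ?thesis using assms unfolding strands_def darts_resolve by simp
qed

text \<open>Each crossing of the glued diagram lies in exactly one of the tangles, so its states are
  pairs of states, and weights multiply.\<close>

theorem bracket_glue:
  fixes T :: "'c tvert diagram" and T' :: "'d tvert diagram"
  assumes "strands T" "strands T'"
  shows "bracket (glue T T') = (\<Sum>\<sigma>\<in>Pow (classical T). \<Sum>\<tau>\<in>Pow (classical T').
    weight T \<sigma> * weight T' \<tau> * loop_value ^ (curves (glue (resolve T \<sigma>) (resolve T' \<tau>)) - 1))"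
proof -
  let ?C = "classical T" and ?C' = "classical T'" and ?G = "glue T T'"
  have fin: "finite (verts ?G)"
  proof -
    have "finite (verts T)" "finite (verts T')" using assms by (auto simp: strands_def)
    moreover have "verts ?G \<subseteq> in_vert ` verts T \<union> out_vert ` verts T' \<union> Seam ` {1..4}"
      by (auto simp: glue_def rev_image_eqI)
    ultimately show ?thesis by (meson finite_UnI finite_atLeastAtMost finite_imageI finite_subset)
  qed
  have finC: "finite ?C" "finite ?C'" using assms by (auto simp: strands_def classical_def)
  have inj: "inj_on (in_vert :: _ \<Rightarrow> ('c, 'd) gvert) ?C" "inj_on (out_vert :: _ \<Rightarrow> ('c, 'd) gvert) ?C'"
    by (rule inj_vert[OF assms(1)], rule inj_vert[OF assms(2)])
  note dis = in_out_vert_disjoint[OF assms]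
  have w: "weight ?G (in_vert ` \<sigma> \<union> out_vert ` \<tau>) = weight T \<sigma> * weight T' \<tau>"
    if "\<sigma> \<subseteq> ?C" "\<tau> \<subseteq> ?C'" for \<sigma> \<tau>
  proof -
    have card_union: "card (in_vert ` s \<union> out_vert ` t :: ('c, 'd) gvert set) = card s + card t"
      if "s \<subseteq> ?C" "t \<subseteq> ?C'" for s t
    proof -
      have "finite s" "finite t" using that finC finite_subset by blast+
      moreover have "in_vert ` s \<inter> out_vert ` t = ({} :: ('c, 'd) gvert set)" using dis that by blast
      ultimately show ?thesis
        using card_image[OF inj_on_subset[OF inj(1) that(1)]] card_image[OF inj_on_subset[OF inj(2) that(2)]]
        by (simp add: card_Un_disjoint)
    qed
    have diff: "(P \<union> Q) - (S \<union> U) = (P - S) \<union> (Q - U)"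
      if "S \<subseteq> P" "U \<subseteq> Q" "P \<inter> Q = {}" for P Q S U :: "('c, 'd) gvert set"
      using that by blast
    have im: "in_vert ` (?C - \<sigma>) = (in_vert ` ?C - in_vert ` \<sigma> :: ('c, 'd) gvert set)"
      "out_vert ` (?C' - \<tau>) = (out_vert ` ?C' - out_vert ` \<tau> :: ('c, 'd) gvert set)"
      by (rule inj_on_image_set_diff[OF inj(1) Diff_subset that(1)],
          rule inj_on_image_set_diff[OF inj(2) Diff_subset that(2)])
    have "classical ?G - (in_vert ` \<sigma> \<union> out_vert ` \<tau>) = in_vert ` (?C - \<sigma>) \<union> out_vert ` (?C' - \<tau>)"
      unfolding classical_glue[OF assms] im by (rule diff[OF image_mono[OF that(1)] image_mono[OF that(2)] dis])
    then show ?thesis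
      using that by (simp add: weight_def card_union power_add mult_ac)
  qed
  \<comment> \<open>\<open>join\<close> assembles a state from a pair and \<open>split\<close> pulls
    it back along the two vertex maps; this bijection turns the state sum into a double sum.\<close>
  define join :: "'c tvert set \<times> 'd tvert set \<Rightarrow> ('c, 'd) gvert set"
    where "join = (\<lambda>(\<sigma>, \<tau>). in_vert ` \<sigma> \<union> out_vert ` \<tau>)"
  define split where "split \<rho> = ({v \<in> ?C. in_vert v \<in> \<rho>}, {v \<in> ?C'. out_vert v \<in> \<rho>})"
    for \<rho> :: "('c, 'd) gvert set"
  have bij: "bij_betw join (Pow ?C \<times> Pow ?C') (Pow (classical ?G))"
  proof (rule bij_betw_byWitness[where f' = split])
    have "split (join (\<sigma>, \<tau>)) = (\<sigma>, \<tau>)" if sub: "\<sigma> \<subseteq> ?C" "\<tau> \<subseteq> ?C'" for \<sigma> \<tau>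
    proof -
      have "in_vert v \<in> join (\<sigma>, \<tau>) \<longleftrightarrow> v \<in> \<sigma>" if "v \<in> ?C" for v
        using inj_on_image_mem_iff[OF inj(1) that sub(1)] image_mono[OF sub(2), of out_vert] dis that
        unfolding join_def by blast
      moreover have "out_vert v \<in> join (\<sigma>, \<tau>) \<longleftrightarrow> v \<in> \<tau>" if "v \<in> ?C'" for v
        using inj_on_image_mem_iff[OF inj(2) that sub(2)] image_mono[OF sub(1), of in_vert] dis that
        unfolding join_def by blast
      ultimately show ?thesis using sub by (auto simp: split_def)
    qed
    then show "\<forall>st\<in>Pow ?C \<times> Pow ?C'. split (join st) = st" by auto
    show "\<forall>\<rho>\<in>Pow (classical ?G). join (split \<rho>) = \<rho>"
      unfolding classical_glue[OF assms] by (auto simp: join_def split_def)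
    show "join ` (Pow ?C \<times> Pow ?C') \<subseteq> Pow (classical ?G)"
      unfolding classical_glue[OF assms] by (auto simp: join_def)
    show "split ` Pow (classical ?G) \<subseteq> Pow ?C \<times> Pow ?C'"
      by (auto simp: split_def)
  qed
  have "bracket ?G = (\<Sum>\<rho>\<in>Pow (classical ?G). weight ?G \<rho> * loop_value ^ (curves (resolve ?G \<rho>) - 1))"
    by (rule bracket_state_sum[OF fin])
  also have "\<dots> = (\<Sum>st\<in>Pow ?C \<times> Pow ?C'.
      weight ?G (join st) * loop_value ^ (curves (resolve ?G (join st)) - 1))"
    by (rule sum.reindex_bij_betw[OF bij, symmetric])
  also have "\<dots> = (\<Sum>(\<sigma>, \<tau>)\<in>Pow ?C \<times> Pow ?C'.
      weight T \<sigma> * weight T' \<tau> * loop_value ^ (curves (glue (resolve T \<sigma>) (resolve T' \<tau>)) - 1))"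
    by (rule sum.cong) (auto simp: join_def w resolve_glue[OF assms])
  finally show ?thesis by (simp add: sum.cartesian_product)
qed


section \<open>The writhe\<close>

lemma in_dart_eq_Inside: "in_dart x = (Inside c, k) \<longleftrightarrow> x = (Inner c, k)"
  and in_dart_neq_Outside: "in_dart x \<noteq> (Outside d, k)"
  by (cases x; cases "fst x"; auto)+

lemma out_dart_eq_Outside: "out_dart x = (Outside d, k) \<longleftrightarrow> x = (Inner d, k)"
  and out_dart_neq_Inside: "out_dart x \<noteq> (Inside c, k)"
  by (cases x; cases "fst x"; auto)+

lemma tails_glue_iff:
  "(Inside c, k) \<in> tails (glue T T') \<longleftrightarrow> (Inner c, k) \<in> tails T"
  "(Outside d, k) \<in> tails (glue T T') \<longleftrightarrow> (Inner d, k) \<in> tails T'"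
  unfolding glue_def
  by (auto simp: in_dart_eq_Inside in_dart_neq_Outside out_dart_eq_Outside out_dart_neq_Inside
      image_iff eq_commute[of _ "in_dart _"] eq_commute[of _ "out_dart _"])

lemma crossing_sign_glue:
  "crossing_sign (glue T T') (Inside c) = crossing_sign T (Inner c)"
  "crossing_sign (glue T T') (Outside d) = crossing_sign T' (Inner d)"
  by (simp_all add: crossing_sign_def tails_glue_iff)

lemma classical_rho: "classical (rho T) = classical T"
  by (simp add: classical_def rho_def)

lemma turn_eq_Inner: "turn p x = (Inner c, k) \<longleftrightarrow> x = (Inner c, k)"
  by (cases x; cases "fst x"; auto)

text \<open>Reversing every strand complements the tails at a crossing, and the sign depends only on
  whether darts 2 and 3 agree.\<close>

lemma crossing_sign_rho:
  assumes "Inner c \<in> classical T"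
  shows "crossing_sign (rho T) (Inner c) = crossing_sign T (Inner c)"
proof -
  have "(Inner c, k) \<in> tails (rho T) \<longleftrightarrow> (Inner c, k) \<notin> tails T" if "k < 4" for k
    using that assms
    by (auto simp: rho_def image_iff eq_commute[of _ "turn _ _"] turn_eq_Inner darts_def classical_def)
  then show ?thesis by (simp add: crossing_sign_def)
qed

lemma writhe_glue_rho: "writhe (glue (rho T) T') = writhe (glue T T')"
  unfolding writhe_def
proof (rule sum.cong)
  show "classical (glue (rho T) T') = classical (glue T T')"
    by (rule set_eqI, case_tac x) (simp_all add: classical_glue_iff classical_rho)
  show "crossing_sign (glue (rho T) T') v = crossing_sign (glue T T') v"
    if "v \<in> classical (glue T T')" for v
    using that by (cases v) (simp_all add: classical_glue_iff crossing_sign_glue crossing_sign_rho)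
qed

lemma writhe_tangle_closure: "writhe (tangle_closure T m) = writhe (tangle_closure T m')"
  unfolding writhe_def tangle_closure_def
proof (rule sum.cong)
  have arcs: "classical (arcs n T) = {}" for n by (simp add: classical_def arcs_def)
  show "classical (glue T (arcs m T)) = classical (glue T (arcs m' T))"
    by (rule set_eqI, case_tac x) (simp_all add: classical_glue_iff arcs)
  show "crossing_sign (glue T (arcs m T)) v = crossing_sign (glue T (arcs m' T)) v"
    if "v \<in> classical (glue T (arcs m' T))" for v
    using that by (cases v) (simp_all add: classical_glue_iff crossing_sign_glue arcs)
qed

text \<open>A unit divides everything. This absorbs the writhe factor of the closures, which may
  differ from that of the glued link.\<close>

lemma unit_power_dvd: "unit_power m dvd x"
proof -
  have "(- (laurent_A ^ 3)) * (- (laurent_A_inv ^ 3)) = 1"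
    by (simp flip: power_mult_distrib add: laurent_A_inverse)
  then have "- (laurent_A ^ 3) dvd 1" "- (laurent_A_inv ^ 3) dvd 1"
    by (metis dvd_triv_left, metis dvd_triv_right)
  then have "unit_power m dvd 1"
    unfolding unit_power_def using dvd_power_same[of _ 1] by (metis power_one)
  then show ?thesis by (meson dvd_trans one_dvd)
qed


section \<open>Rotation against the planar closures\<close>

lemma strands_tangle: "tangle_diagram p T \<Longrightarrow> strands T"
  unfolding tangle_diagram_def wf_diagram_def strands_def by blast

text \<open>The tails of \<open>rho T\<close> come from a complement in \<open>darts T\<close>, so
  the commutation uses that smoothing preserves the darts.\<close>

lemma resolve_rho: "resolve (rho T) \<sigma> = rho (resolve T \<sigma>)"
  using darts_resolve[of T \<sigma>]
  by (intro diagram.equality) (simp_all add: resolve_def rho_def classical_def fun_eq_iff)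

lemma weight_rho: "weight (rho T) \<sigma> = weight T \<sigma>"
  by (simp add: weight_def classical_rho)

text \<open>This is \<open>a\<^sub>1 - a\<^sub>2\<close> in the notation of the introduction.\<close>

definition planar_part :: "'c tvert diagram \<Rightarrow> laurent" where
  "planar_part T = (\<Sum>\<sigma>\<in>Pow (classical T).
     weight T \<sigma> * loop_value ^ loops (resolve T \<sigma>) * planar_sign (linkage (resolve T \<sigma>)))"

text \<open>For each pair of states the difference is a factor from \<open>T\<close> times a factor
  from \<open>T'\<close> times \<open>d - 1\<close>, so the double sum is a product of two
  sums.\<close>

theorem bracket_glue_rho_diff:
  assumes "strands T" "strands T'"
  shows "bracket (glue T T') - bracket (glue (rho T) T') = planar_part T * planar_part T' * (loop_value - 1)"
  unfolding bracket_glue[OF assms] bracket_glue[OF strands_rho[OF assms(1)] assms(2)]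
    classical_rho weight_rho resolve_rho planar_part_def sum_product
    sum_subtractf[symmetric]
  unfolding sum_distrib_right
proof (intro sum.cong refl)
  fix \<sigma> \<tau>
  let ?S = "resolve T \<sigma>" and ?S' = "resolve T' \<tau>" and ?d = loop_value
  have s: "strands ?S" "strands ?S'" using assms strands_resolve by auto
  let ?n = "loops ?S + loops ?S'"
  have "?d ^ (curves (glue ?S ?S') - 1) - ?d ^ (curves (glue (rho ?S) ?S') - 1) =
      ?d ^ ?n * (planar_sign (linkage ?S) * planar_sign (linkage ?S') * (?d - 1))"
    unfolding curves_glue[OF s] curves_glue_rho[OF s]
    by (rule loop_power_rotated[OF linkage_even_partition linkage_even_partition]) (rule s)+
  then have "weight T \<sigma> * weight T' \<tau> * (?d ^ (curves (glue ?S ?S') - 1) - ?d ^ (curves (glue (rho ?S) ?S') - 1)) =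
     weight T \<sigma> * weight T' \<tau> * (?d ^ ?n * (planar_sign (linkage ?S) * planar_sign (linkage ?S') * (?d - 1)))"
    by simp
  then show "weight T \<sigma> * weight T' \<tau> * ?d ^ (curves (glue ?S ?S') - 1) -
      weight T \<sigma> * weight T' \<tau> * ?d ^ (curves (glue (rho ?S) ?S') - 1) =
      weight T \<sigma> * ?d ^ loops ?S * planar_sign (linkage ?S) *
      (weight T' \<tau> * ?d ^ loops ?S' * planar_sign (linkage ?S')) * (?d - 1)"
    by (simp only: right_diff_distrib[symmetric] power_add mult_ac)
qed

section \<open>Crossingless arcs and the two planar closures\<close>

lemma darts_arcs: "darts (arcs m T) = end_dart ` {1..4}"
  by (auto simp: darts_def arcs_def end_dart_def)

lemma edge_arcs: "edge (arcs m T) (end_dart i) = end_dart (partner m i)"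
  by (simp add: arcs_def end_dart_def)

lemma strands_arcs:
  assumes "\<And>i. i \<in> {1..4} \<Longrightarrow> partner m i \<in> {1..4} \<and> partner m i \<noteq> i \<and> partner m (partner m i) = i"
  shows "strands (arcs m T)"
proof -
  have "\<forall>x \<in> darts (arcs m T). edge (arcs m T) x \<in> darts (arcs m T) \<and> edge (arcs m T) x \<noteq> x \<and>
      edge (arcs m T) (edge (arcs m T) x) = x"
    unfolding darts_arcs using assms by (auto simp: edge_arcs simp del: One_nat_def) (simp add: end_dart_def)
  then show ?thesis unfolding strands_def by (auto simp: arcs_def)
qed

text \<open>The darts at \<open>i\<close> and its partner form a closed set: \<open>edge\<close>
  exchanges them and \<open>thru\<close> fixes both.\<close>

lemma linkage_arcs_notin:
  assumes s: "strands (arcs m T)" and i: "i \<in> {1..4}" and p: "partner m (partner m i) = i"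
    and j: "j \<noteq> i" "j \<noteq> partner m i"
  shows "(i, j) \<notin> linkage (arcs m T)"
proof
  let ?r = "strand_rel (arcs m T)" and ?K = "{end_dart i, end_dart (partner m i)} :: (unit tvert \<times> nat) set"
  assume "(i, j) \<in> linkage (arcs m T)"
  then have "(end_dart i, end_dart j) \<in> ?r\<^sup>*" by (simp add: linkage_def linked_def)
  then have "end_dart j \<in> ?r\<^sup>* `` ?K" by (rule ImageI) simp
  moreover have "?r `` ?K \<subseteq> ?K"
  proof -
    have "w \<in> ?K" if "(u, w) \<in> ?r" "u \<in> ?K" for u w
      using that(1)
    proof (cases rule: strand_relE)
      case edge
      then show ?thesis using that(2) p by (auto simp: edge_arcs)
    next
      case thru
      then have "u \<in> end_dart ` {1..4}" by (simp add: darts_arcs)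
      with thru have "w = u" using thru_end[OF s] by auto
      then show ?thesis using that(2) by simp
    qed
    then show ?thesis by blast
  qed
  then have "?r\<^sup>* `` ?K = ?K" by (rule Image_closed_trancl)
  ultimately have "end_dart j \<in> ?K" by (simp only:)
  then show False using j by (simp add: end_dart_def)
qed

lemma loops_arcs:
  "loops (arcs m T) = 0"
proof -
  have "free_components (strand_rel (arcs m T)) (darts (arcs m T)) (end_dart ` {1..4}) = {}"
    unfolding free_components_def darts_arcs component_def by blast
  then show ?thesis by (simp add: loops_def)
qed

lemma strands_planar_arcs:
  "strands (arcs ((1, 2), (3, 4)) T)" "strands (arcs ((1, 4), (2, 3)) T)"
  by (rule strands_arcs; auto)+

text \<open>Two excluded pairs suffice to single out one of the four even partitions.\<close>

lemma linkage_planar_arcs: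
  "linkage (arcs ((1, 2), (3, 4)) T) = blocks 1 2 3 4"
  "linkage (arcs ((1, 4), (2, 3)) T) = blocks 1 4 2 3"
proof -
  let ?m = "((1, 2), (3, 4)) :: matching" and ?m' = "((1, 4), (2, 3)) :: matching"
  have "(1, 3) \<notin> linkage (arcs ?m T)" "(1, 4) \<notin> linkage (arcs ?m T)"
    by (rule linkage_arcs_notin[OF strands_planar_arcs(1)]; simp)+
  with linkage_even_partition[OF strands_planar_arcs(1), of T]
  show "linkage (arcs ?m T) = blocks 1 2 3 4"
    by (cases rule: even_partition_cases) (auto simp: blocks_def)
  have "(1, 2) \<notin> linkage (arcs ?m' T)" "(1, 3) \<notin> linkage (arcs ?m' T)"
    by (rule linkage_arcs_notin[OF strands_planar_arcs(2)]; simp)+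
  with linkage_even_partition[OF strands_planar_arcs(2), of T]
  show "linkage (arcs ?m' T) = blocks 1 4 2 3"
    by (cases rule: even_partition_cases) (auto simp: blocks_def)
qed

lemma bracket_tangle_closure:
  assumes "strands T" "strands (arcs m T)"
  shows "bracket (tangle_closure T m) = (\<Sum>\<sigma>\<in>Pow (classical T). weight T \<sigma> *
    loop_value ^ (loops (resolve T \<sigma>) + join_count (linkage (resolve T \<sigma>)) (linkage (arcs m T)) - 1))"
proof -
  have arcs: "classical (arcs m T) = {}" by (simp add: classical_def arcs_def)
  then have "weight (arcs m T) {} = 1" "resolve (arcs m T) {} = arcs m T"
    by (auto simp: weight_def resolve_def intro: diagram.equality)
  then show ?thesis
    unfolding tangle_closure_def bracket_glue[OF assms] arcs
    by (simp add: curves_glue[OF strands_resolve[OF assms(1)] assms(2)] loops_arcs)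
qed

text \<open>The arcs have a single state, of weight 1 and without loops, so the closures only see
  the columns of \<open>m\<^sub>1\<close> and \<open>m\<^sub>2\<close> in the matrix of the pairing.
  Their difference is \<open>planar_sign\<close> times \<open>d - 1\<close>.\<close>

theorem bracket_closures_diff:
  assumes "strands T"
  shows "bracket (tangle_closure T ((1, 2), (3, 4))) - bracket (tangle_closure T ((1, 4), (2, 3))) =
    planar_part T * (loop_value - 1)"
  unfolding bracket_tangle_closure[OF assms strands_planar_arcs(1)]
    bracket_tangle_closure[OF assms strands_planar_arcs(2)] linkage_planar_arcs
    planar_part_def sum_subtractf[symmetric] sum_distrib_right right_diff_distrib[symmetric]
    loop_power_closed[OF linkage_even_partition[OF strands_resolve[OF assms]]]
  by (simp only: mult_ac)

theorem theorem3p13: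
  fixes T :: "'c tvert diagram" and T' :: "'d tvert diagram"
  assumes "virtual_tangle T" and "standard_orientation T"
    and "complementary_tangle T'" and "compatible_orientation T T'"
  shows "aux_poly (tangle_closure T ((1, 2), (3, 4))) - aux_poly (tangle_closure T ((1, 4), (2, 3)))
           dvd aux_poly (glue T T') - aux_poly (glue (rho T) T')"
proof -
  have T: "strands T" and T': "strands T'"
    using assms strands_tangle by (auto simp: virtual_tangle_def complementary_tangle_def)
  \<comment> \<open>Both closures have the same writhe, so one unit \<open>?w\<close> serves for
    both.\<close>
  let ?w = "unit_power (- writhe (tangle_closure T ((1, 4), (2, 3))))"
  let ?b = "planar_part T * (loop_value - 1)"
  have "aux_poly (tangle_closure T ((1, 2), (3, 4))) - aux_poly (tangle_closure T ((1, 4), (2, 3))) = ?w * ?b"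
    unfolding aux_poly_def writhe_tangle_closure[of T "((1, 2), (3, 4))" "((1, 4), (2, 3))"]
      right_diff_distrib[symmetric] bracket_closures_diff[OF T] ..
  moreover have "aux_poly (glue T T') - aux_poly (glue (rho T) T') =
      (unit_power (- writhe (glue T T')) * planar_part T') * ?b"
    unfolding aux_poly_def writhe_glue_rho right_diff_distrib[symmetric] bracket_glue_rho_diff[OF T T']
    by (simp only: mult_ac)
  \<comment> \<open>The unit \<open>?w\<close> divides the cofactor, and \<open>?b\<close> is common
    to both sides.\<close>
  ultimately show ?thesis
    using mult_dvd_mono[OF unit_power_dvd dvd_refl] by metis
qed

end
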